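(* Let $\mathcal D_4\subset\mathcal B_4\subset\mathcal F_4\subset\mathbb P^3=\mathbb P^3_{\mathbb C}$ be the sets of $12$, $16$ and $24$ points obtained by projectivizing the root systems $D_4\subset B_4\subset F_4\subset\mathbb R^4$. Then the Waldschmidt constants of these sets are $$\widehat\alpha(\mathcal D_4)=\widehat\alpha(\mathcal B_4)=2\qquad\text{and}\qquad \widehat\alpha(\mathcal F_4)=\frac83 .$$
   Context: Waldschmidt constant: for a finite set of points $Z\subset\mathbb P^N$ with homogeneous ideal $I=\bigcap_{P\in Z}I(P)\subset\mathbb C[x_0,\dots,x_N]$, let $I^{(m)}=\bigcap_{P\in Z}I(P)^m$ be the $m$th symbolic power and let $\alpha(I^{(m)})$ be the least degree of a nonzero homogeneous polynomial in $I^{(m)}$. Then $\widehat\alpha(Z)=\inf_{m\ge 1}\alpha(I^{(m)})/m$. The point sets: - $\mathcal D_4$ consists of the $12$ points of $\mathbb P^3$ whose coordinates are permutations of $(\pm1:1:0:0)$ (the projectivization of the $24$ vectors that are permutations of $(\pm1,\pm1,0,0)$). - $\mathcal B_4$ is the union of $\mathcal D_4$ and the four coordinate points $(1:0:0:0),(0:1:0:0),(0:0:1:0),(0:0:0:1)$. - $\mathcal F_4$ is the union of $\mathcal B_4$ and the $8$ points $(\pm1:\pm1:\pm1:\pm1)$ (all choices of signs, up to a common sign). *)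

theory Defs
  imports "HOL-Analysis.Analysis" "HOL-Library.Poly_Mapping"
begin

section \<open>Homogeneous coordinates and polynomials\<close>

text \<open>A point of projective space is the set of all its (nonzero) homogeneous coordinate
  vectors; the ambient dimension is one less than the cardinality of the index type.\<close>

definition proj_pt :: "complex ^ 'n \<Rightarrow> (complex ^ 'n) set"
  where "proj_pt v = {c *s v | c. c \<noteq> 0}"

definition projectivize :: "(real ^ 'n) set \<Rightarrow> (complex ^ 'n) set set"
  where "projectivize R = (\<lambda>v. proj_pt (\<chi> i. complex_of_real (v $ i))) ` R"

text \<open>Multivariate polynomials are finitely supported maps from exponent vectors to
  coefficients, with the convolution product of the library.\<close>

type_synonym 'n mpol = "('n \<Rightarrow>\<^sub>0 nat) \<Rightarrow>\<^sub>0 complex"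

definition eval_mpol :: "complex ^ 'n \<Rightarrow> 'n mpol \<Rightarrow> complex"
  where "eval_mpol x f =
    (\<Sum>a\<in>Poly_Mapping.keys f. Poly_Mapping.lookup f a * (\<Prod>i\<in>UNIV. (x $ i) ^ Poly_Mapping.lookup a i))"

definition homogeneous :: "nat \<Rightarrow> ('n::finite) mpol \<Rightarrow> bool"
  where "homogeneous d f \<longleftrightarrow>
    (\<forall>a\<in>Poly_Mapping.keys f. (\<Sum>i\<in>UNIV. Poly_Mapping.lookup a i) = d)"

section \<open>Ideals, symbolic powers and the Waldschmidt constant\<close>

text \<open>The ideal generated by a set: the span in the ring viewed as a module over itself.\<close>

definition ideal_gen :: "'a::comm_ring_1 set \<Rightarrow> 'a set"
  where "ideal_gen S = module.span (*) S"

fun ideal_pow :: "'a::comm_ring_1 set \<Rightarrow> nat \<Rightarrow> 'a set" where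
  "ideal_pow J 0 = UNIV"
| "ideal_pow J (Suc m) = ideal_gen {f * g | f g. f \<in> J \<and> g \<in> ideal_pow J m}"

definition point_ideal :: "(complex ^ 'n) set \<Rightarrow> ('n::finite) mpol set"
  where "point_ideal P =
    ideal_gen {f. (\<exists>d. homogeneous d f) \<and> (\<forall>x\<in>P. eval_mpol x f = 0)}"

definition symbolic_power :: "(complex ^ 'n) set set \<Rightarrow> nat \<Rightarrow> ('n::finite) mpol set"
  where "symbolic_power Z m = (\<Inter>P\<in>Z. ideal_pow (point_ideal P) m)"

definition initial_degree :: "('n::finite) mpol set \<Rightarrow> nat"
  where "initial_degree J = (LEAST d. \<exists>f\<in>J. f \<noteq> 0 \<and> homogeneous d f)"

definition waldschmidt :: "(complex ^ ('n::finite)) set set \<Rightarrow> real"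
  where "waldschmidt Z =
    (INF m\<in>{1..}. real (initial_degree (symbolic_power Z m)) / real m)"

section \<open>The root systems and their projectivizations\<close>

definition D4_roots :: "(real ^ 4) set"
  where "D4_roots = {axis i s + axis j t | i j s t. i \<noteq> j \<and> s \<in> {1, -1} \<and> t \<in> {1, -1}}"

definition B4_roots :: "(real ^ 4) set"
  where "B4_roots = D4_roots \<union> {axis i s | i s. s \<in> {1, -1}}"

text \<open>The short roots with half-integral coordinates give the points
  \<open>(\<plusminus>1:\<plusminus>1:\<plusminus>1:\<plusminus>1)\<close>; see \<open>projectivize_F4\<close> below.\<close>

definition F4_roots :: "(real ^ 4) set"
  where "F4_roots = B4_roots \<union> {v. \<forall>i. v $ i \<in> {1/2, -1/2}}"

definition D4_points :: "(complex ^ 4) set set"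
  where "D4_points = projectivize D4_roots"

definition B4_points :: "(complex ^ 4) set set"
  where "B4_points = projectivize B4_roots"

definition F4_points :: "(complex ^ 4) set set"
  where "F4_points = projectivize F4_roots"

section \<open>Explicit coordinates, inclusions and cardinalities\<close>

text \<open>One representative for each pair of opposite roots, scaled to be integral.\<close>

definition vec4 :: "real \<Rightarrow> real \<Rightarrow> real \<Rightarrow> real \<Rightarrow> real ^ 4"
  where "vec4 a b c d = (\<chi> i. if i = 1 then a else if i = 2 then b else if i = 3 then c else d)"

lemma vec4_nth: "vec4 a b c d $ 1 = a" "vec4 a b c d $ 2 = b" "vec4 a b c d $ 3 = c" "vec4 a b c d $ 4 = d"
  by (simp_all add: vec4_def)

lemma vec4_inject: "vec4 a b c d = vec4 a' b' c' d' \<longleftrightarrow> a = a' \<and> b = b' \<and> c = c' \<and> d = d'"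
  by (auto simp: vec_eq_iff forall_4 vec4_nth)

definition "D4_reps = {vec4 1 1 0 0, vec4 1 0 1 0, vec4 1 0 0 1, vec4 1 0 0 (-1),
    vec4 1 0 (-1) 0, vec4 1 (-1) 0 0, vec4 0 1 1 0, vec4 0 1 0 1,
    vec4 0 1 0 (-1), vec4 0 1 (-1) 0, vec4 0 0 1 1, vec4 0 0 1 (-1)}"

definition "coord_reps = {vec4 1 0 0 0, vec4 0 1 0 0, vec4 0 0 1 0, vec4 0 0 0 1}"

definition "sign_reps = {vec4 1 1 1 1, vec4 1 1 1 (-1), vec4 1 1 (-1) 1, vec4 1 1 (-1) (-1),
    vec4 1 (-1) 1 1, vec4 1 (-1) 1 (-1), vec4 1 (-1) (-1) 1, vec4 1 (-1) (-1) (-1)}"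


lemma proj_pt_smult: "c \<noteq> 0 \<Longrightarrow> proj_pt (c *s v) = proj_pt v"
proof -
  assume c: "c \<noteq> 0"
  have "x \<in> proj_pt (c *s v)" if x: "x \<in> proj_pt v" for x
  proof -
    from x obtain b where b: "b \<noteq> 0" "x = b *s v" by (auto simp: proj_pt_def)
    then have "x = (b / c) *s (c *s v)" "b / c \<noteq> 0" using c by (simp_all add: vector_smult_assoc)
    then show ?thesis unfolding proj_pt_def by blast
  qed
  moreover have "x \<in> proj_pt v" if "x \<in> proj_pt (c *s v)" for x
  proof -
    from that obtain b where "b \<noteq> 0" "x = b *s (c *s v)" by (auto simp: proj_pt_def)
    then have "x = (b * c) *s v" "b * c \<noteq> 0" using c by (simp_all add: vector_smult_assoc)
    then show ?thesis unfolding proj_pt_def by blast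
  qed
  ultimately show ?thesis by blast
qed

lemma projectivize_eqI:
  assumes "\<And>v. v \<in> R \<Longrightarrow> \<exists>w\<in>S. \<exists>c. c \<noteq> 0 \<and> v = c *\<^sub>R w"
    and "\<And>w. w \<in> S \<Longrightarrow> \<exists>v\<in>R. \<exists>c. c \<noteq> 0 \<and> w = c *\<^sub>R v"
  shows "projectivize R = projectivize S"
proof -
  have e: "proj_pt (\<chi> i. complex_of_real ((c *\<^sub>R w) $ i)) = proj_pt (\<chi> i. complex_of_real (w $ i))"
    if "c \<noteq> 0" for c and w :: "real ^ 'a"
  proof -
    have "(\<chi> i. complex_of_real ((c *\<^sub>R w) $ i)) = complex_of_real c *s (\<chi> i. complex_of_real (w $ i))"
      by (simp add: vec_eq_iff)
    then show ?thesis using that by (metis proj_pt_smult of_real_eq_0_iff)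
  qed
  show ?thesis
  proof
    show "projectivize R \<subseteq> projectivize S"
      unfolding projectivize_def using assms(1) e by (fastforce simp: image_iff)
    show "projectivize S \<subseteq> projectivize R"
      unfolding projectivize_def using assms(2) e by (fastforce simp: image_iff)
  qed
qed

text \<open>The first nonzero coordinate is 1.\<close>

definition leading_one :: "real ^ 4 \<Rightarrow> bool"
  where "leading_one v \<longleftrightarrow> v $ 1 = 1 \<or> v $ 1 = 0 \<and> (v $ 2 = 1 \<or> v $ 2 = 0 \<and> (v $ 3 = 1 \<or> v $ 3 = 0 \<and> v $ 4 = 1))"

lemma card_projectivize:
  assumes "\<And>v. v \<in> S \<Longrightarrow> leading_one v"
  shows "card (projectivize S) = card S"
  unfolding projectivize_def
proof (rule card_image, rule inj_onI)
  fix v w assume vw: "v \<in> S" "w \<in> S"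
    and eq: "proj_pt (\<chi> i. complex_of_real (v $ i)) = proj_pt (\<chi> i. complex_of_real (w $ i))"
  have "(\<chi> i. complex_of_real (v $ i)) \<in> proj_pt (\<chi> i. complex_of_real (v $ i))"
    unfolding proj_pt_def by (auto intro!: exI[of _ 1])
  then obtain c where c: "c \<noteq> 0" "(\<chi> i. complex_of_real (v $ i)) = c *s (\<chi> i. complex_of_real (w $ i))"
    unfolding eq by (auto simp: proj_pt_def)
  then have *: "complex_of_real (v $ i) = c * complex_of_real (w $ i)" for i
    by (simp add: vec_eq_iff)
  have "c = 1"
    using assms[OF vw(1)] assms[OF vw(2)] *[of 1] *[of 2] *[of 3] *[of 4] c(1)
    unfolding leading_one_def by auto
  with * show "v = w" by (simp add: vec_eq_iff)
qed

lemma ex_scale_pm: "w \<in> S \<Longrightarrow> v = w \<or> v = - w \<Longrightarrow> \<exists>w\<in>S. \<exists>c. c \<noteq> 0 \<and> v = c *\<^sub>R (w :: real ^ 4)"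
  by (metis one_neq_zero neg_equal_0_iff_equal scaleR_one scaleR_minus_left)

lemma vec4_minus: "- vec4 a b c d = vec4 (-a) (-b) (-c) (-d)"
  by (auto simp: vec_eq_iff forall_4 vec4_nth)

lemma axis_vec4: 
  "axis 1 s = vec4 s 0 0 0" "axis 2 s = vec4 0 s 0 0" "axis 3 s = vec4 0 0 s 0" "axis 4 s = vec4 0 0 0 s"
  "vec4 a b c d + vec4 a' b' c' d' = vec4 (a+a') (b+b') (c+c') (d+d')"
  by (auto simp: vec_eq_iff forall_4 vec4_nth axis_def)

lemma D4_pm: "v \<in> D4_roots \<longleftrightarrow> v \<in> D4_reps \<or> - v \<in> D4_reps"
proof -
  have "v \<in> D4_reps \<or> - v \<in> D4_reps" if "v \<in> D4_roots"
  proof -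
    from that obtain i j s t where "v = axis i s + axis j t" "i \<noteq> j" "s = 1 \<or> s = -1" "t = 1 \<or> t = -1"
      by (auto simp: D4_roots_def)
    with exhaust_4[of i] exhaust_4[of j] show ?thesis
      by (elim disjE) (simp_all add: axis_vec4 vec4_minus D4_reps_def vec4_inject)
  qed
  moreover have r: "axis i s + axis j t \<in> D4_roots" if "i \<noteq> j" "s \<in> {1,-1}" "t \<in> {1,-1}" for i j s t
    using that unfolding D4_roots_def by blast
  have D: "D4_reps \<subseteq> D4_roots"
    using r[of 1 2] r[of 1 3] r[of 1 4] r[of 2 3] r[of 2 4] r[of 3 4]
    by (simp add: D4_reps_def axis_vec4)
  have "- v \<in> D4_roots" if "v \<in> D4_roots" for v
  proof -
    from that obtain i j s t where *: "v = axis i s + axis j t" "i \<noteq> j" "s \<in> {1,-1}" "t \<in> {1,-1}"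
      by (auto simp: D4_roots_def)
    have "- v = axis i (-s) + axis j (-t)" by (simp add: * vec_eq_iff axis_def)
    with r[of i j "-s" "-t"] * show ?thesis by auto
  qed
  with D have "v \<in> D4_roots" if "v \<in> D4_reps \<or> - v \<in> D4_reps"
    using that by (metis minus_minus subsetD)
  ultimately show ?thesis by blast
qed

lemma B4_pm: "v \<in> B4_roots \<longleftrightarrow> v \<in> D4_reps \<union> coord_reps \<or> - v \<in> D4_reps \<union> coord_reps"
proof -
  have ax: "axis i s \<in> coord_reps \<or> - axis i s \<in> coord_reps" if "s \<in> {1, -1}" for i :: 4 and s :: real
    using that exhaust_4[of i] by (auto simp: coord_reps_def axis_vec4 vec4_minus vec4_inject)
  have 1: "\<exists>i. u = axis i 1" if "u \<in> coord_reps" for u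
    using that unfolding coord_reps_def axis_vec4[symmetric] by blast
  have neg: "- axis i (1::real) = axis i (-1)" for i :: 4
    by (simp add: vec_eq_iff axis_def)
  have "(\<exists>i s. v = axis i s \<and> (s = 1 \<or> s = -1)) \<longleftrightarrow> v \<in> coord_reps \<or> - v \<in> coord_reps"
  proof
    assume "v \<in> coord_reps \<or> - v \<in> coord_reps"
    then show "\<exists>i s. v = axis i s \<and> (s = 1 \<or> s = -1)"
      using 1[of v] 1[of "- v"] neg by (metis minus_minus)
  qed (use ax in auto)
  then show ?thesis by (auto simp: B4_roots_def D4_pm)
qed

lemma projectivize_D4: "D4_points = projectivize D4_reps"
  unfolding D4_points_def
  by (rule projectivize_eqI; (metis D4_pm ex_scale_pm minus_minus))

lemma projectivize_B4: "B4_points = projectivize (D4_reps \<union> coord_reps)"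
  unfolding B4_points_def
  by (rule projectivize_eqI; (metis B4_pm ex_scale_pm minus_minus))

lemma sign_pm: "(\<forall>i. v $ i \<in> {1/2, -1/2}) \<longleftrightarrow> 2 *\<^sub>R v \<in> sign_reps \<or> - 2 *\<^sub>R v \<in> sign_reps"
proof -
  obtain a b c d where v: "v = vec4 a b c d"
    by (rule that[of "v$1" "v$2" "v$3" "v$4"]) (simp add: vec_eq_iff forall_4 vec4_nth)
  have 1: "2 *\<^sub>R v = vec4 (2*a) (2*b) (2*c) (2*d)" "- 2 *\<^sub>R v = vec4 (-2*a) (-2*b) (-2*c) (-2*d)"
    by (simp_all add: v vec_eq_iff forall_4 vec4_nth)
  have 2: "2 * a = 1 \<longleftrightarrow> a = 1/2" "2 * a = -1 \<longleftrightarrow> a = -1/2" "-2 * a = 1 \<longleftrightarrow> a = -1/2" "-2 * a = -1 \<longleftrightarrow> a = 1/2"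
    for a :: real by auto
  show ?thesis
    unfolding 1 sign_reps_def insert_iff empty_iff vec4_inject 2 unfolding v forall_4 vec4_nth insert_iff empty_iff
    by argo
qed

lemma projectivize_F4: "F4_points = projectivize (D4_reps \<union> coord_reps \<union> sign_reps)"
  unfolding F4_points_def
proof (rule projectivize_eqI)
  fix v assume "v \<in> F4_roots"
  then consider "v \<in> B4_roots" | "2 *\<^sub>R v \<in> sign_reps" | "- 2 *\<^sub>R v \<in> sign_reps"
    unfolding F4_roots_def using sign_pm[of v] by blast
  then show "\<exists>w\<in>D4_reps \<union> coord_reps \<union> sign_reps. \<exists>c. c \<noteq> 0 \<and> v = c *\<^sub>R w"
  proof cases
    case 1 then show ?thesis by (metis B4_pm UnI1 ex_scale_pm minus_minus)
  next
    case 2 then show ?thesis by (intro bexI[of _ "2 *\<^sub>R v"] exI[of _ "1/2"]) auto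
  next
    case 3 then show ?thesis by (intro bexI[of _ "- 2 *\<^sub>R v"] exI[of _ "-1/2"]) auto
  qed
next
  fix w assume "w \<in> D4_reps \<union> coord_reps \<union> sign_reps"
  then consider "w \<in> B4_roots" | "w \<in> sign_reps" using B4_pm by blast
  then show "\<exists>v\<in>F4_roots. \<exists>c. c \<noteq> 0 \<and> w = c *\<^sub>R v"
  proof cases
    case 1 then show ?thesis by (intro bexI[of _ w] exI[of _ 1]) (auto simp: F4_roots_def)
  next
    case 2
    then have "(1/2) *\<^sub>R w \<in> F4_roots" using sign_pm[of "(1/2) *\<^sub>R w"] by (simp add: F4_roots_def)
    then show ?thesis by (intro bexI[of _ "(1/2) *\<^sub>R w"] exI[of _ 2]) auto
  qed
qed

lemma card_D4_points: "card D4_points = 12"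
  and card_B4_points: "card B4_points = 16"
  and card_F4_points: "card F4_points = 24"
  unfolding projectivize_D4 projectivize_B4 projectivize_F4
  by (subst card_projectivize;
      force simp: D4_reps_def coord_reps_def sign_reps_def leading_one_def vec4_nth vec4_inject)+

lemma D4_B4_F4_points: "D4_points \<subset> B4_points" "B4_points \<subset> F4_points"
proof -
  have "D4_points \<subseteq> B4_points" "B4_points \<subseteq> F4_points"
    unfolding D4_points_def B4_points_def F4_points_def projectivize_def B4_roots_def F4_roots_def by blast+
  with card_D4_points card_B4_points card_F4_points
  show "D4_points \<subset> B4_points" "B4_points \<subset> F4_points" by force+
qed

end

theory Submission
  imports Defs
begin

text \<open>The upper bounds come from the four coordinate planes (each point of \<open>B\<^sub>4\<close> lies on at least two)
  and from the 24 mirrors of \<open>F\<^sub>4\<close> (each point lies on nine). For the lower bounds, a form whose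
  degree is too small for its multiplicities must vanish on each of these planes; dividing by all
  of them preserves the strict inequality between degree and multiplicity, and one concludes by
  descent on the degree.

  On such a plane the points form a \<open>D\<^sub>3\<close> or \<open>B\<^sub>3\<close> configuration, which alone only gives the ratio
  \<open>5/2\<close> for \<open>F\<^sub>4\<close>. The missing input is that a form of degree \<open>d\<close> with multiplicity \<open>m\<close> at three
  collinear points has multiplicity at least \<open>(3m - d)/2\<close> along the whole line: for \<open>F\<^sub>4\<close> this
  produces four additional multiple points on every mirror.\<close>

section \<open>Forms on complex coordinate space\<close>

text \<open>Both constants come out of one inequality. On a mirror, a form of degree d with
  multiplicities i, j, k at the points of type (1:1:0), (1:0:0), (1:1:1) vanishes if 6d < 12i + 3j +
  6k. For D4 only i = m is available, and this reads d < 2m. For F4 one has i = j = m, and k = (3m -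
  d)/2 turns it into 9d < 24m, that is, into the ratio 8/3. The same ratios are the number of planes
  over the multiplicity in the two arrangements, 4/2 and 24/9. Hence division by a whole arrangement
  is exactly neutral for the inequality, and the upper bounds meet the lower ones. The case of B4 is
  enclosed: its lower bound uses the multiplicities at D4 alone, its upper bound the incidences at
  all 16 points.\<close>

definition linear_form :: "(complex ^ 'n \<Rightarrow> complex) \<Rightarrow> bool"
  where "linear_form l \<longleftrightarrow> (\<forall>x y. l (x + y) = l x + l y) \<and> (\<forall>c x. l (c *s x) = c * l x)"

lemma linear_form_add: "linear_form l \<Longrightarrow> l (x + y) = l x + l y"
  and linear_form_smult: "linear_form l \<Longrightarrow> l (c *s x) = c * l x"
  by (auto simp: linear_form_def)

lemma linear_form_diff: "linear_form l \<Longrightarrow> l (x - y) = l x - l y"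
  using linear_form_add[of l "x - y" y] by simp

text \<open>Homogeneous polynomials are handled as functions: restriction to a line or a plane is
  then plain composition, and closure properties follow by induction on the generation. The zero
  function is a form of every degree, so nonvanishing is always carried as a separate
  assumption.\<close>

inductive form :: "nat \<Rightarrow> (complex ^ 'n \<Rightarrow> complex) \<Rightarrow> bool" where
  const: "form 0 (\<lambda>_. c)"
| linear: "linear_form l \<Longrightarrow> form 1 l"
| add: "form d f \<Longrightarrow> form d g \<Longrightarrow> form d (\<lambda>x. f x + g x)"
| mult: "form d f \<Longrightarrow> form e g \<Longrightarrow> form (d + e) (\<lambda>x. f x * g x)"

lemma linear_form_coord: "linear_form (\<lambda>x. x $ i)"
  by (simp add: linear_form_def)

lemma form_zero: "form d (\<lambda>_. 0)"
proof (induction d)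
  case 0 show ?case by (rule form.const)
next
  case (Suc d)
  then show ?case
    using form.mult[OF Suc form.linear[OF linear_form_coord]] by simp
qed

lemma form_scale:
  assumes "form d f"
  shows "form d (\<lambda>x. c * f x)"
  using form.mult[OF form.const[of c] assms] by simp

lemma form_sum:
  assumes "\<And>i. i \<in> A \<Longrightarrow> form d (f i)"
  shows "form d (\<lambda>x. \<Sum>i\<in>A. f i x)"
  using assms by (induction A rule: infinite_finite_induct) (simp_all add: form_zero form.add)

lemma form_power_coord: "form n (\<lambda>x. x $ i ^ n)"
proof (induction n)
  case 0
  then show ?case using form.const[of 1] by simp
next
  case (Suc n)
  then show ?case using form.mult[OF form.linear[OF linear_form_coord] Suc] by simp
qed

lemma form_prod:
  assumes "finite A" "\<And>i. i \<in> A \<Longrightarrow> form (d i) (f i)"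
  shows "form (\<Sum>i\<in>A. d i) (\<lambda>x. \<Prod>i\<in>A. f i x)"
  using assms
proof (induction A rule: finite_induct)
  case empty
  then show ?case using form.const[of 1] by simp
next
  case (insert i A)
  then show ?case using form.mult[of "d i" "f i" "\<Sum>i\<in>A. d i" "\<lambda>x. \<Prod>i\<in>A. f i x"] by simp
qed

lemma form_homogeneous: "form d f \<Longrightarrow> f (c *s x) = c ^ d * f x"
  by (induction rule: form.induct) (auto simp: linear_form_smult algebra_simps power_add)

lemma form_compose:
  assumes "form d f" "\<And>x y. g (x + y) = g x + g y" "\<And>c x. g (c *s x) = c *s g x"
  shows "form d (\<lambda>x. f (g x))"
  using assms(1)
proof (induction rule: form.induct)
  case (linear l)
  then have "linear_form (\<lambda>x. l (g x))"
    unfolding linear_form_def using assms by simp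
  then show ?case by (rule form.linear)
qed (simp_all add: form.const form.add form.mult)

lemma form_line:
  assumes "form d f"
  shows "\<exists>p. degree p \<le> d \<and> (\<forall>t. f (a + t *s b) = poly p t)"
  using assms
proof (induction rule: form.induct)
  case (const c)
  show ?case by (rule exI[of _ "[:c:]"]) simp
next
  case (linear l)
  then show ?case
    by (intro exI[of _ "[:l a, l b:]"]) (auto simp: linear_form_add linear_form_smult)
next
  case (add d f g)
  from add.IH obtain p q where "degree p \<le> d" "degree q \<le> d"
    "\<And>t. f (a + t *s b) = poly p t" "\<And>t. g (a + t *s b) = poly q t" by blast
  then show ?case by (intro exI[of _ "p + q"]) (auto simp: degree_add_le)
next
  case (mult d f e g)
  from mult.IH obtain p q where "degree p \<le> d" "degree q \<le> e"
    "\<And>t. f (a + t *s b) = poly p t" "\<And>t. g (a + t *s b) = poly q t" by blast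
  then show ?case
    using degree_mult_le[of p q] by (intro exI[of _ "p * q"]) auto
qed

text \<open>The direction of the line is allowed to vary with \<open>s\<close>: the outer variable
  of \<open>q\<close> is \<open>s\<close>, its coefficients are polynomials in \<open>t\<close>.
  This is what the limit argument in \<open>vanishes_divide\<close> needs.\<close>

lemma form_line2:
  assumes "form d f"
  shows "\<exists>q :: complex poly poly. \<forall>s t. f (a + t *s (b + s *s c)) = poly (poly q [:s:]) t"
  using assms
proof (induction rule: form.induct)
  case (const c)
  show ?case by (rule exI[of _ "[:[:c:]:]"]) simp
next
  case (linear l)
  then show ?case
    by (intro exI[of _ "[:[:l a, l b:], [:0, l c:]:]"])
      (auto simp: linear_form_add linear_form_smult algebra_simps)
next
  case (add d f g)
  from add.IH obtain p q where
    "\<And>s t. f (a + t *s (b + s *s c)) = poly (poly p [:s:]) t"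
    "\<And>s t. g (a + t *s (b + s *s c)) = poly (poly q [:s:]) t" by blast
  then show ?case by (intro exI[of _ "p + q"]) auto
next
  case (mult d f e g)
  from mult.IH obtain p q where
    "\<And>s t. f (a + t *s (b + s *s c)) = poly (poly p [:s:]) t"
    "\<And>s t. g (a + t *s (b + s *s c)) = poly (poly q [:s:]) t" by blast
  then show ?case by (intro exI[of _ "p * q"]) auto
qed

lemma poly_ext:
  fixes p q :: "complex poly"
  assumes "\<And>t. poly p t = poly q t"
  shows "p = q"
  using assms poly_eq_poly_eq_iff[of p q] by blast

lemma poly_zero_cofinite:
  fixes p :: "complex poly"
  assumes "\<And>t. t \<noteq> c \<Longrightarrow> poly p t = 0"
  shows "p = 0"
proof (rule ccontr)
  assume "p \<noteq> 0"
  then have "finite {t. poly p t = 0}" by (rule poly_roots_finite)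
  moreover have "- {c} \<subseteq> {t. poly p t = 0}" using assms by auto
  ultimately have "finite (- {c})" by (rule rev_finite_subset)
  then show False by (simp add: infinite_UNIV_char_0)
qed

text \<open>\<open>x - l x *s v\<close> is the projection onto \<open>l = 0\<close> along
  \<open>v\<close>. For products the remainder telescopes: FG - AB = (F - A)G + A(G - B). Degree 0
  is split off because there the quotient is zero, whereas \<open>d - 1\<close> would
  truncate.\<close>

lemma form_divide:
  assumes "form d f" "linear_form l" "l v = 1"
  shows "\<exists>h. (\<forall>x. f x = f (x - l x *s v) + l x * h x) \<and>
    (case d of 0 \<Rightarrow> h = (\<lambda>_. 0) | Suc e \<Rightarrow> form e h)"
  using assms(1)
proof (induction rule: form.induct)
  case (const c)
  show ?case by (rule exI[of _ "\<lambda>_. 0"]) simp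
next
  case (linear k)
  have "form 0 (\<lambda>_. k v)" by (rule form.const)
  then show ?case using linear
    by (intro exI[of _ "\<lambda>_. k v"]) (simp add: linear_form_diff linear_form_smult)
next
  case (add d f g)
  from add.IH obtain h k where hk:
    "\<forall>x. f x = f (x - l x *s v) + l x * h x" "\<forall>x. g x = g (x - l x *s v) + l x * k x"
    "case d of 0 \<Rightarrow> h = (\<lambda>_. 0) | Suc e \<Rightarrow> form e h" "case d of 0 \<Rightarrow> k = (\<lambda>_. 0) | Suc e \<Rightarrow> form e k"
    by (elim exE conjE)
  have eq: "F + G = A + B + L * (H + K)" if "F = A + L * H" "G = B + L * K" for F G A B L H K :: complex
    unfolding that by (simp add: algebra_simps)
  show ?case
  proof (intro exI conjI allI)
    show "f x + g x = f (x - l x *s v) + g (x - l x *s v) + l x * (h x + k x)" for x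
      by (rule eq[OF hk(1)[rule_format] hk(2)[rule_format]])
    show "case d of 0 \<Rightarrow> (\<lambda>x. h x + k x) = (\<lambda>_. 0) | Suc e \<Rightarrow> form e (\<lambda>x. h x + k x)"
      using hk(3,4) by (cases d) (simp_all add: form.add)
  qed
next
  case (mult d f e g)
  from mult.IH obtain h k where hk:
    "\<forall>x. f x = f (x - l x *s v) + l x * h x" "\<forall>x. g x = g (x - l x *s v) + l x * k x"
    "case d of 0 \<Rightarrow> h = (\<lambda>_. 0) | Suc e \<Rightarrow> form e h" "case e of 0 \<Rightarrow> k = (\<lambda>_. 0) | Suc e \<Rightarrow> form e k"
    by (elim exE conjE)
  have eq: "F * G = A * B + L * (H * G + A * K)" if "F = A + L * H" "G = B + L * K" for F G A B L H K :: complex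
    unfolding that by (simp add: algebra_simps)
  let ?h = "\<lambda>x. h x * g x + f (x - l x *s v) * k x"
  have f: "form d (\<lambda>x. f (x - l x *s v))"
    by (rule form_compose[OF mult.hyps(1)])
      (simp_all add: linear_form_add[OF assms(2)] linear_form_smult[OF assms(2)] vec_eq_iff algebra_simps)
  show ?case
  proof (intro exI conjI allI)
    show "f x * g x = f (x - l x *s v) * g (x - l x *s v) + l x * ?h x" for x
      by (rule eq[OF hk(1)[rule_format] hk(2)[rule_format]])
    show "case d + e of 0 \<Rightarrow> ?h = (\<lambda>_. 0) | Suc e \<Rightarrow> form e ?h"
    proof (cases d)
      case 0
      then have h: "h = (\<lambda>_. 0)" using hk(3) by simp
      show ?thesis
        using 0 h hk(4) f form.mult[of d "\<lambda>x. f (x - l x *s v)" "e - 1" k] by (cases e) simp_all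
    next
      case (Suc d')
      then have "form (d' + e) (\<lambda>x. h x * g x)" using hk(3) mult.hyps(2) by (simp add: form.mult)
      then show ?thesis
        using Suc hk(4) form.add form.mult[OF f, of "e - 1" k] by (cases e) (simp_all add: form.add)
    qed
  qed
qed

lemma form_divide_hyperplane:
  assumes "form d f" "linear_form l" "l v \<noteq> 0" "\<And>x. l x = 0 \<Longrightarrow> f x = 0" "f y \<noteq> 0"
  obtains e h where "d = Suc e" "form e h" "\<And>x. f x = l x * h x"
proof -
  let ?v = "(1 / l v) *s v"
  have v: "l ?v = 1" using assms by (simp add: linear_form_smult)
  obtain h where h: "\<And>x. f x = f (x - l x *s ?v) + l x * h x"
    "case d of 0 \<Rightarrow> h = (\<lambda>_. 0) | Suc e \<Rightarrow> form e h"
    using form_divide[OF assms(1,2) v] by blast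
  have *: "f x = l x * h x" for x
    using h(1)[of x] assms(4)[of "x - l x *s ?v"] assms(2,3) by (simp add: linear_form_diff linear_form_smult)
  then show ?thesis using that h(2) assms(5) by (cases d) auto
qed

section \<open>Multiplicity at a point\<close>

text \<open>Multiplicity at least \<open>m\<close>, tested on all lines through the representative
  \<open>a\<close> in the affine cone, without derivatives or local rings.\<close>

definition vanishes :: "nat \<Rightarrow> (complex ^ 'n \<Rightarrow> complex) \<Rightarrow> complex ^ 'n \<Rightarrow> bool"
  where "vanishes m f a \<longleftrightarrow> (\<forall>b. \<exists>p. \<forall>t. f (a + t *s b) = t ^ m * poly p t)"

lemma vanishesE:
  assumes "vanishes m f a"
  obtains p where "\<And>t. f (a + t *s b) = t ^ m * poly p t"
  using assms unfolding vanishes_def by blast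

lemma vanishes_scale:
  assumes "form d f" "vanishes m f a" "c \<noteq> 0"
  shows "vanishes m f (c *s a)"
  unfolding vanishes_def
proof
  fix b
  obtain p where p: "\<And>t. f (a + t *s b) = t ^ m * poly p t" using vanishesE[OF assms(2)] by blast
  have "f (c *s a + t *s b) = t ^ m * poly (smult (c ^ d / c ^ m) (pcompose p [:0, 1 / c:])) t" for t
  proof -
    have "c *s a + t *s b = c *s (a + (t / c) *s b)" using assms(3) by (simp add: vec_eq_iff algebra_simps)
    then have "f (c *s a + t *s b) = c ^ d * (t / c) ^ m * poly p (t / c)"
      by (metis form_homogeneous[OF assms(1)] p mult.assoc)
    then show ?thesis by (simp add: poly_pcompose power_divide)
  qed
  then show "\<exists>p. \<forall>t. f (c *s a + t *s b) = t ^ m * poly p t" by blast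
qed

lemma vanishes_compose:
  assumes "vanishes m f (g a)" "\<And>x y. g (x + y) = g x + g y" "\<And>c x. g (c *s x) = c *s g x"
  shows "vanishes m (\<lambda>x. f (g x)) a"
  using assms unfolding vanishes_def by simp

lemma vanishes_0: "form d f \<Longrightarrow> vanishes 0 f a"
  unfolding vanishes_def using form_line[of d f a] by fastforce

lemma vanishes_add: "vanishes m f a \<Longrightarrow> vanishes m g a \<Longrightarrow> vanishes m (\<lambda>x. f x + g x) a"
  unfolding vanishes_def
proof
  fix b
  assume "\<forall>b. \<exists>p. \<forall>t. f (a + t *s b) = t ^ m * poly p t" "\<forall>b. \<exists>p. \<forall>t. g (a + t *s b) = t ^ m * poly p t"
  then obtain p q where "\<forall>t. f (a + t *s b) = t ^ m * poly p t" "\<forall>t. g (a + t *s b) = t ^ m * poly q t" by blast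
  then show "\<exists>p. \<forall>t. f (a + t *s b) + g (a + t *s b) = t ^ m * poly p t"
    by (intro exI[of _ "p + q"]) (simp add: algebra_simps)
qed

lemma vanishes_mult: "vanishes m f a \<Longrightarrow> vanishes n g a \<Longrightarrow> vanishes (m + n) (\<lambda>x. f x * g x) a"
  unfolding vanishes_def
proof
  fix b
  assume "\<forall>b. \<exists>p. \<forall>t. f (a + t *s b) = t ^ m * poly p t" "\<forall>b. \<exists>p. \<forall>t. g (a + t *s b) = t ^ n * poly p t"
  then obtain p q where "\<forall>t. f (a + t *s b) = t ^ m * poly p t" "\<forall>t. g (a + t *s b) = t ^ n * poly q t" by blast
  then show "\<exists>p. \<forall>t. f (a + t *s b) * g (a + t *s b) = t ^ (m + n) * poly p t"
    by (intro exI[of _ "p * q"]) (simp add: algebra_simps power_add)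
qed

lemma vanishes_iff_dvd:
  fixes p :: "complex poly"
  assumes "\<And>t. f (a + t *s b) = poly p t"
  shows "(\<exists>q. \<forall>t. f (a + t *s b) = t ^ m * poly q t) \<longleftrightarrow> monom 1 m dvd p"
proof -
  have "(\<forall>t. f (a + t *s b) = t ^ m * poly q t) \<longleftrightarrow> p = monom 1 m * q" for q
    unfolding assms by (auto simp: poly_monom intro!: poly_ext[of p])
  then show ?thesis by (auto simp: dvd_def)
qed

text \<open>On a line through \<open>a\<close> the factor \<open>l\<close> becomes
  \<open>l a + t * l b\<close>. If \<open>l a\<close> is nonzero it has order 0 at
  \<open>t = 0\<close> and costs nothing. If \<open>l a = 0\<close> and \<open>l b\<close> is
  nonzero it costs exactly one power of \<open>t\<close>. If both vanish, the product is zero on the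
  line and tells nothing about \<open>h\<close> there.\<close>

lemma vanishes_divide:
  assumes h: "form e h" and l: "linear_form l" "l v \<noteq> 0" and m: "vanishes m (\<lambda>x. l x * h x) a"
  shows "vanishes (if l a = 0 then m - 1 else m) h a"
proof -
  have lin: "l (a + t *s b) = l a + t * l b" for t b
    by (simp add: linear_form_add[OF l(1)] linear_form_smult[OF l(1)])
  have prod: "monom 1 m dvd [:l a, l b:] * r" if r: "\<And>t. h (a + t *s b) = poly r t" for r b
  proof -
    have "l (a + t *s b) * h (a + t *s b) = poly ([:l a, l b:] * r) t" for t
      by (simp only: lin r poly_mult) simp
    moreover obtain p where "\<And>t. l (a + t *s b) * h (a + t *s b) = t ^ m * poly p t"
      using vanishesE[OF m] by blast
    ultimately have "poly ([:l a, l b:] * r) t = poly (monom 1 m * p) t" for t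
      by (simp only: poly_mult poly_monom mult_1)
    then have "[:l a, l b:] * r = monom 1 m * p" by (rule poly_ext)
    then show ?thesis by simp
  qed
  show ?thesis
  proof (cases "l a = 0")
    case nz: False
    have "\<exists>q. \<forall>t. h (a + t *s b) = t ^ m * poly q t" for b
    proof -
      obtain q where q: "\<And>t. h (a + t *s b) = poly q t" using form_line[OF h] by blast
      have "monom 1 m dvd q"
      proof (cases "q = 0")
        case False
        have n: "[:l a, l b:] * q \<noteq> 0"
          unfolding mult_eq_0_iff using nz False by simp
        have "m \<le> order 0 ([:l a, l b:] * q)"
          using prod[OF q] unfolding monom_1_dvd_iff[OF n] .
        also have "\<dots> = order 0 [:l a, l b:] + order 0 q"
          using n by (rule order_mult)
        also have "order 0 [:l a, l b:] = 0" using nz by (intro order_0I) simp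
        finally show ?thesis using False by (simp add: monom_1_dvd_iff)
      qed simp
      then show ?thesis using vanishes_iff_dvd[of h a b q m, OF q] by simp
    qed
    then show ?thesis using nz by (simp add: vanishes_def)
  next
    case True
    show ?thesis
    proof (cases m)
      case 0 then show ?thesis using vanishes_0[OF h] by simp
    next
      case (Suc k)
      have dvd: "monom 1 k dvd r" if r: "\<And>t. h (a + t *s b) = poly r t" and b: "l b \<noteq> 0" for b r
      proof -
        have "[:0, l b:] * r = monom 1 1 * smult (l b) r" by (simp add: monom_altdef)
        then have "monom 1 1 * monom 1 k dvd monom 1 1 * smult (l b) r"
          using prod[OF r] True Suc by (simp add: mult_monom)
        then have "monom 1 k dvd smult (l b) r" by (subst (asm) dvd_mult_cancel_left) auto
        then show ?thesis using b by (simp add: dvd_smult_iff)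
      qed
      have "\<exists>q. \<forall>t. h (a + t *s b) = t ^ k * poly q t" for b
      proof (cases "l b = 0")
        case False
        obtain q where q: "\<And>t. h (a + t *s b) = poly q t" using form_line[OF h] by blast
        then show ?thesis using vanishes_iff_dvd[of h a b q k, OF q] dvd[OF q False] by simp
      next
        case lb: True
        obtain q where q: "\<And>s t. h (a + t *s (b + s *s v)) = poly (poly q [:s:]) t"
          using form_line2[OF h] by blast
        \<comment> \<open>Directions inside the hyperplane are limits of transversal ones.\<close>
        have "coeff (poly q [:0:]) j = 0" if "j < k" for j
        proof -
          \<comment> \<open>The coefficient of \<open>t ^ j\<close> is itself a polynomial in
            \<open>s\<close>; it vanishes for all nonzero \<open>s\<close>, hence at
            \<open>s = 0\<close>.\<close>
          have c: "coeff (poly q [:s:]) j = poly (map_poly (\<lambda>c. coeff c j) q) s" for s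
            by (induction q) (auto simp: map_poly_pCons)
          have "poly (map_poly (\<lambda>c. coeff c j) q) s = 0" if "s \<noteq> 0" for s
          proof -
            have "l (b + s *s v) \<noteq> 0"
              using that lb l by (simp add: linear_form_add[OF l(1)] linear_form_smult[OF l(1)])
            then have "monom 1 k dvd poly q [:s:]" by (rule dvd[OF q])
            then show ?thesis using \<open>j < k\<close> by (simp add: c[symmetric] monom_1_dvd_iff')
          qed
          then have "map_poly (\<lambda>c. coeff c j) q = 0" by (rule poly_zero_cofinite)
          then show ?thesis unfolding c by simp
        qed
        then have "monom 1 k dvd poly q [:0:]" by (simp add: monom_1_dvd_iff')
        moreover have "\<And>t. h (a + t *s b) = poly (poly q [:0:]) t" using q[of _ 0] by simp
        ultimately show ?thesis using vanishes_iff_dvd[of h a b "poly q [:0:]" k] by simp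
      qed
      then show ?thesis using True Suc by (simp add: vanishes_def)
    qed
  qed
qed

text \<open>Bezout on a line: the orders at the marked points add up to more than the degree of the
  restriction.\<close>

lemma vanishes_line:
  assumes f: "form d f" and T: "finite T" "\<And>t. t \<in> T \<Longrightarrow> vanishes (m t) f (a + t *s b)"
    and d: "d < (\<Sum>t\<in>T. m t)"
  shows "f (x *s a + y *s b) = 0"
proof -
  obtain p where p: "degree p \<le> d" "\<And>t. f (a + t *s b) = poly p t" using form_line[OF f] by blast
  have p0: "p = 0"
  proof (rule ccontr)
    assume "p \<noteq> 0"
    have ord: "m t \<le> order t p" if t: "t \<in> T" for t
    proof -
      obtain q where q: "\<And>s. f ((a + t *s b) + s *s b) = s ^ m t * poly q s"
        using vanishesE[OF T(2)[OF t]] by blast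
      have "poly p s = poly ([:- t, 1:] ^ m t * pcompose q [:- t, 1:]) s" for s
      proof -
        have "poly p s = f ((a + t *s b) + (s - t) *s b)"
          unfolding p(2)[symmetric] by (simp add: vec_eq_iff algebra_simps)
        also have "\<dots> = (s - t) ^ m t * poly q (s - t)" by (rule q)
        finally show ?thesis by (simp add: poly_pcompose)
      qed
      then have "p = [:- t, 1:] ^ m t * pcompose q [:- t, 1:]" by (rule poly_ext)
      then have "[:- t, 1:] ^ m t dvd p" by (rule dvdI)
      then show ?thesis using \<open>p \<noteq> 0\<close> by (simp add: order_divides)
    qed
    have "(\<Sum>t\<in>T. m t) \<le> (\<Sum>t\<in>T. order t p)" using ord by (rule sum_mono)
    also have "\<dots> = (\<Sum>t\<in>T \<inter> {t. poly p t = 0}. order t p)"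
      using T(1) by (intro sum.mono_neutral_right) (auto simp: order_0I)
    also have "\<dots> \<le> (\<Sum>t | poly p t = 0. order t p)"
      using poly_roots_finite[OF \<open>p \<noteq> 0\<close>] by (intro sum_mono2) auto
    also have "\<dots> \<le> degree p" using \<open>p \<noteq> 0\<close> by (rule sum_order_le_degree)
    finally show False using d p(1) by simp
  qed
  have *: "f (x *s a + y *s b) = 0" if "x \<noteq> 0" for x
  proof -
    have "x *s a + y *s b = x *s (a + (y / x) *s b)" using that by (simp add: vec_eq_iff algebra_simps)
    then show ?thesis by (simp only: form_homogeneous[OF f] p(2) p0) simp
  qed
  \<comment> \<open>The multiples of \<open>b\<close> lie outside the chart
    \<open>a + t *s b\<close>; they are reached by moving in the direction \<open>a\<close>.\<close>
  obtain q where q: "\<And>t. f (y *s b + t *s a) = poly q t" using form_line[OF f] by blast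
  have "poly q t = 0" if "t \<noteq> 0" for t
    using *[OF that] unfolding q[of t, symmetric] by (simp only: add.commute)
  then have "q = 0" by (rule poly_zero_cofinite)
  then show ?thesis using q[of x] by (simp add: add.commute)
qed

text \<open>After division by \<open>l\<close>, the quotient must still vanish on the later
  hyperplanes. The sorting condition says that none of them lies inside \<open>l = 0\<close>, so
  that each later hyperplane has a direction leaving \<open>l = 0\<close>.\<close>

lemma divide_linear_forms:
  assumes "form d f" "f y \<noteq> 0"
    and "\<And>l. l \<in> set ls \<Longrightarrow> linear_form l \<and> (\<exists>v. l v \<noteq> 0) \<and> (\<forall>x. l x = 0 \<longrightarrow> f x = 0)"
    and "sorted_wrt (\<lambda>l l'. \<exists>x. l' x = 0 \<and> l x \<noteq> 0) ls"
  shows "\<exists>h. length ls \<le> d \<and> form (d - length ls) h \<and> (\<exists>x. h x \<noteq> 0) \<and>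
    (\<forall>a m. vanishes m f a \<longrightarrow> vanishes (m - length (filter (\<lambda>l. l a = 0) ls)) h a)"
  using assms
proof (induction ls arbitrary: d f y)
  case Nil
  then show ?case by auto
next
  case (Cons l ls)
  from Cons.prems(3)[of l] obtain v where l: "linear_form l" "l v \<noteq> 0" "\<And>x. l x = 0 \<Longrightarrow> f x = 0" by auto
  obtain e g where g: "d = Suc e" "form e g" "\<And>x. f x = l x * g x"
    using form_divide_hyperplane[OF Cons.prems(1) l Cons.prems(2)] by blast
  have "linear_form k \<and> (\<exists>v. k v \<noteq> 0) \<and> (\<forall>x. k x = 0 \<longrightarrow> g x = 0)" if k: "k \<in> set ls" for k
  proof -
    from k Cons.prems(3)[of k] have k1: "linear_form k" "\<exists>v. k v \<noteq> 0" "\<And>x. k x = 0 \<Longrightarrow> f x = 0" by auto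
    from k Cons.prems(4) obtain z where z: "k z = 0" "l z \<noteq> 0" by auto
    have "g x = 0" if x: "k x = 0" for x
    proof -
      obtain p where p: "\<And>t. g (x + t *s z) = poly p t" using form_line[OF g(2)] by blast
      \<comment> \<open>The line \<open>x + t *s z\<close> stays inside \<open>k = 0\<close> but
        meets \<open>l = 0\<close> in a single point.\<close>
      have "poly p t = 0" if "t \<noteq> - l x / l z" for t
      proof -
        have "l (x + t *s z) * g (x + t *s z) = 0"
          using k1(3)[of "x + t *s z"] x z(1) g(3) by (simp add: linear_form_add[OF k1(1)] linear_form_smult[OF k1(1)])
        moreover have "l (x + t *s z) \<noteq> 0"
          using that z(2) by (auto simp: linear_form_add[OF l(1)] linear_form_smult[OF l(1)] field_simps add_eq_0_iff)
        ultimately show ?thesis by (simp only: p mult_eq_0_iff) simp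
      qed
      then have "p = 0" by (rule poly_zero_cofinite)
      then show ?thesis using p[of 0] by simp
    qed
    with k1 show ?thesis by blast
  qed
  moreover have "g y \<noteq> 0" using g(3)[of y] Cons.prems(2) by auto
  moreover have "sorted_wrt (\<lambda>l l'. \<exists>x. l' x = 0 \<and> l x \<noteq> 0) ls" using Cons.prems(4) by simp
  ultimately obtain h where h: "length ls \<le> e" "form (e - length ls) h" "\<exists>x. h x \<noteq> 0"
    "\<And>a m. vanishes m g a \<Longrightarrow> vanishes (m - length (filter (\<lambda>l. l a = 0) ls)) h a"
    using Cons.IH[OF g(2)] by blast
  have "vanishes (m - length (filter (\<lambda>l. l a = 0) (l # ls))) h a" if m: "vanishes m f a" for a m
  proof -
    have "vanishes (if l a = 0 then m - 1 else m) g a"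
      using vanishes_divide[OF g(2) l(1,2)] m unfolding g(3)[abs_def] .
    from h(4)[OF this] show ?thesis by (cases "l a = 0") auto
  qed
  with h(1-3) g(1) show ?case by (intro exI[of _ h] conjI allI impI) simp_all
qed

section \<open>Lines with three or four marked points\<close>

lemma line3_vanish:
  assumes f: "form d f" and v: "vanishes i f a" "vanishes j f b" "vanishes k f (a + b)"
    and d: "d < i + j + k"
  shows "f (x *s a + y *s b) = 0"
proof -
  \<comment> \<open>The parametrization keeps all marked points of the line in the affine chart.\<close>
  let ?c = "a + 2 *s b" and ?m = "\<lambda>t :: complex. if t = 0 then i else if t = -1 then j else k"
  have e: "a + (-1) *s ?c = (-2) *s b" "a + 1 *s ?c = 2 *s (a + b)"
    by (simp_all add: vec_eq_iff algebra_simps)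
  have "vanishes (?m t) f (a + t *s ?c)" if "t \<in> {0, -1, 1}" for t
    using that v vanishes_scale[OF f v(2), of "-2"] vanishes_scale[OF f v(3), of 2]
    unfolding insert_iff empty_iff by (elim disjE) (simp_all only: e, simp_all)
  then have "f ((x - y / 2) *s a + (y / 2) *s ?c) = 0"
    by (rule vanishes_line[OF f, where T = "{0, -1, 1}" and m = ?m, rotated]) (use d in auto)
  moreover have "(x - y / 2) *s a + (y / 2) *s ?c = x *s a + y *s b"
    by (simp add: vec_eq_iff algebra_simps)
  ultimately show ?thesis by simp
qed

lemma line4_vanish:
  assumes f: "form d f"
    and v: "vanishes i f a" "vanishes j f b" "vanishes k f (a + b)" "vanishes n f (a - b)"
    and d: "d < i + j + k + n"
  shows "f (x *s a + y *s b) = 0"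
proof -
  \<comment> \<open>Since \<open>?c\<close> is unmarked, all four points are finite: up to scaling,
    \<open>t = 0, -1, 1, -1/3\<close> give \<open>a\<close>, \<open>b\<close>, \<open>a + b\<close>,
    \<open>a - b\<close>.\<close>
  let ?c = "a + 2 *s b"
    and ?m = "\<lambda>t :: complex. if t = 0 then i else if t = -1 then j else if t = 1 then k else n"
  have e: "a + (-1) *s ?c = (-2) *s b" "a + 1 *s ?c = 2 *s (a + b)" "a + (-1/3) *s ?c = (2/3) *s (a - b)"
    by (simp_all add: vec_eq_iff algebra_simps)
  have n: "- (1 / 3) \<noteq> (1 :: complex)" by (simp add: complex_eq_iff)
  have "vanishes (?m t) f (a + t *s ?c)" if "t \<in> {0, -1, 1, -1/3}" for t
    using that v vanishes_scale[OF f v(2), of "-2"] vanishes_scale[OF f v(3), of 2]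
      vanishes_scale[OF f v(4), of "2/3"]
    unfolding insert_iff empty_iff by (elim disjE) (simp_all only: e, simp_all add: n)
  then have "f ((x - y / 2) *s a + (y / 2) *s ?c) = 0"
    by (rule vanishes_line[OF f, where T = "{0, -1, 1, -1/3}" and m = ?m, rotated]) (use d n in auto)
  moreover have "(x - y / 2) *s a + (y / 2) *s ?c = x *s a + y *s b"
    by (simp add: vec_eq_iff algebra_simps)
  ultimately show ?thesis by simp
qed

section \<open>Linear forms given by coefficient vectors\<close>

definition lf :: "complex ^ 'n \<Rightarrow> complex ^ 'n \<Rightarrow> complex"
  where "lf c x = (\<Sum>i\<in>UNIV. c $ i * x $ i)"

lemma linear_form_lf: "linear_form (lf c)"
  by (simp add: linear_form_def lf_def sum.distrib sum_distrib_left algebra_simps)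

text \<open>The hypothesis is a nonzero Gram determinant. The witness is \<open>c\<close> made
  orthogonal to \<open>c'\<close> without division, and \<open>lf c\<close> takes the Gram
  determinant as its value there.\<close>

lemma lf_independent:
  assumes "lf c c * lf c' c' \<noteq> (lf c c')\<^sup>2"
  shows "\<exists>x. lf c' x = 0 \<and> lf c x \<noteq> 0"
proof (intro exI conjI)
  let ?x = "lf c' c' *s c + (- lf c c') *s c'"
  have *: "lf c' c = lf c c'" by (simp add: lf_def mult.commute)
  show "lf c' ?x = 0"
    by (simp only: linear_form_add[OF linear_form_lf] linear_form_smult[OF linear_form_lf] *) simp
  show "lf c ?x \<noteq> 0"
    using assms
    by (simp only: linear_form_add[OF linear_form_lf] linear_form_smult[OF linear_form_lf] *)
      (simp add: power2_eq_square mult.commute)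
qed

section \<open>Plane curves through the points of the root system \<open>B\<^sub>3\<close>\<close>

text \<open>Each line contains three of the six \<open>D\<^sub>3\<close> points, the positive roots
  of a subsystem \<open>A\<^sub>2\<close>.\<close>

definition A2_lines :: "(complex ^ 3) list"
  where "A2_lines = [vector [1, 1, 1], vector [1, 1, -1], vector [1, -1, 1], vector [1, -1, -1]]"

text \<open>The mirrors of \<open>D\<^sub>3\<close>. Each contains one \<open>D\<^sub>3\<close>
  point, one coordinate point and two points (\<plusminus>1:\<plusminus>1:\<plusminus>1), in the
  position required by \<open>line4_vanish\<close>.\<close>

definition diagonal_lines :: "(complex ^ 3) list"
  where "diagonal_lines = [vector [1, 1, 0], vector [1, -1, 0], vector [1, 0, 1], vector [1, 0, -1],
    vector [0, 1, 1], vector [0, 1, -1]]"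

lemma sorted_lines:
  "sorted_wrt (\<lambda>l l'. \<exists>x. l' x = 0 \<and> l x \<noteq> 0) (map lf A2_lines)"
  "sorted_wrt (\<lambda>l l'. \<exists>x. l' x = 0 \<and> l x \<noteq> 0) (map lf diagonal_lines)"
  unfolding sorted_wrt_map
  by (rule sorted_wrt_mono_rel[of _ "\<lambda>c c'. lf c c * lf c' c' \<noteq> (lf c c')\<^sup>2"],
      simp add: lf_independent, simp add: A2_lines_def diagonal_lines_def lf_def sum_3)+

lemma count_lines:
  assumes "r \<in> {1, -1}" "s \<in> {1, -1}" "t \<in> {1, -1}"
  shows "length (filter (\<lambda>l. l (vector [s, t, 0]) = 0) (map lf A2_lines)) = 2"
    "length (filter (\<lambda>l. l (vector [s, 0, t]) = 0) (map lf A2_lines)) = 2"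
    "length (filter (\<lambda>l. l (vector [0, s, t]) = 0) (map lf A2_lines)) = 2"
    "length (filter (\<lambda>l. l (vector [1, 0, 0]) = 0) (map lf A2_lines)) = 0"
    "length (filter (\<lambda>l. l (vector [0, 1, 0]) = 0) (map lf A2_lines)) = 0"
    "length (filter (\<lambda>l. l (vector [0, 0, 1]) = 0) (map lf A2_lines)) = 0"
    "length (filter (\<lambda>l. l (vector [r, s, t]) = 0) (map lf A2_lines)) = 0"
    "length (filter (\<lambda>l. l (vector [s, t, 0]) = 0) (map lf diagonal_lines)) = 1"
    "length (filter (\<lambda>l. l (vector [s, 0, t]) = 0) (map lf diagonal_lines)) = 1"
    "length (filter (\<lambda>l. l (vector [0, s, t]) = 0) (map lf diagonal_lines)) = 1"
    "length (filter (\<lambda>l. l (vector [1, 0, 0]) = 0) (map lf diagonal_lines)) = 2"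
    "length (filter (\<lambda>l. l (vector [0, 1, 0]) = 0) (map lf diagonal_lines)) = 2"
    "length (filter (\<lambda>l. l (vector [0, 0, 1]) = 0) (map lf diagonal_lines)) = 2"
    "length (filter (\<lambda>l. l (vector [r, s, t]) = 0) (map lf diagonal_lines)) = 3"
  using assms by (auto simp: A2_lines_def diagonal_lines_def lf_def sum_3)

text \<open>The weights come from the nef class \<open>N\<close> of sextics with multiplicity \<open>2\<close> at the six
  \<open>D\<^sub>3\<close> points, \<open>1\<close> at the coordinate points and \<open>3/2\<close> at the points \<open>(\<plusminus>1:\<plusminus>1:\<plusminus>1)\<close>. As \<open>N\<close> is \<open>3/4\<close> of
  the sum of \<open>A2_lines\<close> plus \<open>1/2\<close> of the sum of \<open>diagonal_lines\<close> and has degree \<open>0\<close> on each of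
  them, a curve of negative degree against \<open>N\<close> contains one of the two families of lines, and
  removing it leaves the degree against \<open>N\<close> unchanged.\<close>

lemma B3_vanish:
  fixes f :: "complex ^ 3 \<Rightarrow> complex"
  assumes "form d f"
    and "\<And>s t. s \<in> {1, -1} \<Longrightarrow> t \<in> {1, -1} \<Longrightarrow>
      vanishes i f (vector [s, t, 0]) \<and> vanishes i f (vector [s, 0, t]) \<and> vanishes i f (vector [0, s, t])"
    and "vanishes j f (vector [1, 0, 0])" "vanishes j f (vector [0, 1, 0])" "vanishes j f (vector [0, 0, 1])"
    and "\<And>r s t. r \<in> {1, -1} \<Longrightarrow> s \<in> {1, -1} \<Longrightarrow> t \<in> {1, -1} \<Longrightarrow> vanishes k f (vector [r, s, t])"
    and "6 * d < 12 * i + 3 * j + 6 * k"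
  shows "f x = 0"
  using assms
proof (induction d arbitrary: f i j k x rule: less_induct)
  case (less d f i j k x)
  note f = less.prems(1)
  have vec3: "vector [a, b, c] + vector [a', b', c'] = (vector [a + a', b + b', c + c'] :: complex ^ 3)"
    "vector [a, b, c] - vector [a', b', c'] = (vector [a - a', b - b', c - c'] :: complex ^ 3)"
    for a b c a' b' c' by (simp_all add: vec_eq_iff forall_3)
  show ?case
  proof (rule ccontr)
    assume nz: "f x \<noteq> 0"
    show False
    proof (cases "d < 3 * i")
      case True
      have line: "f y = 0" if st: "s \<in> {1, -1}" "t \<in> {1, -1}" and y: "y $ 1 + s * y $ 2 + t * y $ 3 = 0" for s t y
      proof -
        let ?a = "vector [1, - s, 0] :: complex ^ 3" and ?b = "vector [-1, 0, t] :: complex ^ 3"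
        have ab: "?a + ?b = vector [0, - s, t]" by (simp add: vec_eq_iff forall_3)
        have *: "vanishes i f ?a" "vanishes i f ?b" "vanishes i f (?a + ?b)"
          unfolding ab using less.prems(2)[of 1 "- s"] less.prems(2)[of "-1" t] less.prems(2)[of "- s" t] st by auto
        have y1: "y $ 1 = - s * y $ 2 - t * y $ 3" using y by algebra
        from line3_vanish[OF f *, of "- s * y $ 2" "t * y $ 3"] True
        have "f ((- s * y $ 2) *s ?a + (t * y $ 3) *s ?b) = 0" by simp
        moreover have "(- s * y $ 2) *s ?a + (t * y $ 3) *s ?b = y"
          using st y1 by (auto simp: vec_eq_iff forall_3)
        ultimately show ?thesis by simp
      qed
      have len: "length (map lf A2_lines) = 4" by (simp add: A2_lines_def)
      have "linear_form l \<and> (\<exists>v. l v \<noteq> 0) \<and> (\<forall>x. l x = 0 \<longrightarrow> f x = 0)" if "l \<in> set (map lf A2_lines)" for l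
      proof -
        from that obtain s t where st: "s \<in> {1, -1}" "t \<in> {1, -1}" "l = lf (vector [1, s, t])"
          by (auto simp: A2_lines_def)
        have "l (vector [1, 0, 0]) \<noteq> 0" by (simp add: st lf_def sum_3)
        then show ?thesis using line[OF st(1,2)] by (auto simp: st(3) linear_form_lf) (auto simp: lf_def sum_3)
      qed
      then obtain h where h: "4 \<le> d" "form (d - 4) h" "\<exists>x. h x \<noteq> 0"
        "\<And>a m. vanishes m f a \<Longrightarrow> vanishes (m - length (filter (\<lambda>l. l a = 0) (map lf A2_lines))) h a"
        using divide_linear_forms[OF f nz _ sorted_lines(1)] unfolding len by blast
      have "h y = 0" for y
      proof (rule less.IH[OF _ h(2), of "i - 2" j k])
        show "d - 4 < d" using h(1) by simp
        show "vanishes (i - 2) h (vector [s, t, 0]) \<and> vanishes (i - 2) h (vector [s, 0, t]) \<and>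
          vanishes (i - 2) h (vector [0, s, t])" if "s \<in> {1, -1}" "t \<in> {1, -1}" for s t
          using h(4)[of i "vector [s, t, 0]"] h(4)[of i "vector [s, 0, t]"] h(4)[of i "vector [0, s, t]"]
            less.prems(2)[OF that] count_lines(1-3)[of 1, OF _ that] by simp
        show "vanishes j h (vector [1, 0, 0])" "vanishes j h (vector [0, 1, 0])" "vanishes j h (vector [0, 0, 1])"
          using h(4)[OF less.prems(3)] h(4)[OF less.prems(4)] h(4)[OF less.prems(5)]
            count_lines(4-6)[of 1 1 1] by simp_all
        show "vanishes k h (vector [r, s, t])" if "r \<in> {1, -1}" "s \<in> {1, -1}" "t \<in> {1, -1}" for r s t
          using h(4)[OF less.prems(6)[OF that]] count_lines(7)[OF that] by simp
        \<comment> \<open>Balanced because 6 * 4 = 12 * 2; truncation of \<open>i - 2\<close> at 0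
          can only enlarge the right side.\<close>
        show "6 * (d - 4) < 12 * (i - 2) + 3 * j + 6 * k" using less.prems(7) h(1) by linarith
      qed
      with h(3) show False by blast
    next
      case False
      \<comment> \<open>The hypothesis gives j + 2k > 2d - 4i, and 2d - 4i \<ge> d - i because d
        \<ge> 3i.\<close>
      then have d: "d < i + j + k + k" using less.prems(7) by linarith
      have line: "f y = 0" if ab: "vanishes i f a" "vanishes j f b" "vanishes k f (a + b)" "vanishes k f (a - b)"
        and y: "y = u *s a + v *s b" for a b u v y
        using line4_vanish[OF f ab d] y by simp
      have len: "length (map lf diagonal_lines) = 6" by (simp add: diagonal_lines_def)
      have "linear_form l \<and> (\<exists>v. l v \<noteq> 0) \<and> (\<forall>x. l x = 0 \<longrightarrow> f x = 0)" if "l \<in> set (map lf diagonal_lines)" for l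
      proof -
        have "\<exists>s\<in>{1, -1}. l = lf (vector [1, - s, 0]) \<or> l = lf (vector [1, 0, - s]) \<or> l = lf (vector [0, 1, - s])"
          using that by (auto simp: diagonal_lines_def)
        then obtain s where st: "s \<in> {1, -1}"
          and l: "l = lf (vector [1, - s, 0]) \<or> l = lf (vector [1, 0, - s]) \<or> l = lf (vector [0, 1, - s])"
          by blast
        have "f y = 0" if "l y = 0" for y
          using l
        proof (elim disjE)
          assume l: "l = lf (vector [1, - s, 0])"
          show ?thesis
          proof (rule line[of "vector [s, 1, 0]" "vector [0, 0, 1]" _ "y $ 2" "y $ 3"])
            show "vanishes k f (vector [s, 1, 0] + vector [0, 0, 1])" "vanishes k f (vector [s, 1, 0] - vector [0, 0, 1])"
              using less.prems(6)[of s 1 1] less.prems(6)[of s 1 "-1"] st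
              by (simp_all add: vec3)
            show "y = y $ 2 *s vector [s, 1, 0] + y $ 3 *s vector [0, 0, 1]"
              using that l by (simp add: vec_eq_iff forall_3 lf_def sum_3 mult.commute)
          qed (use less.prems(2)[of s 1] less.prems(5) st in auto)
        next
          assume l: "l = lf (vector [1, 0, - s])"
          show ?thesis
          proof (rule line[of "vector [s, 0, 1]" "vector [0, 1, 0]" _ "y $ 3" "y $ 2"])
            show "vanishes k f (vector [s, 0, 1] + vector [0, 1, 0])" "vanishes k f (vector [s, 0, 1] - vector [0, 1, 0])"
              using less.prems(6)[of s 1 1] less.prems(6)[of s "-1" 1] st
              by (simp_all add: vec3)
            show "y = y $ 3 *s vector [s, 0, 1] + y $ 2 *s vector [0, 1, 0]"
              using that l by (simp add: vec_eq_iff forall_3 lf_def sum_3 mult.commute)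
          qed (use less.prems(2)[of s 1] less.prems(4) st in auto)
        next
          assume l: "l = lf (vector [0, 1, - s])"
          show ?thesis
          proof (rule line[of "vector [0, s, 1]" "vector [1, 0, 0]" _ "y $ 3" "y $ 1"])
            show "vanishes k f (vector [0, s, 1] + vector [1, 0, 0])" "vanishes k f (vector [0, s, 1] - vector [1, 0, 0])"
              using less.prems(6)[of 1 s 1] less.prems(6)[of "-1" s 1] st
              by (simp_all add: vec3)
            show "y = y $ 3 *s vector [0, s, 1] + y $ 1 *s vector [1, 0, 0]"
              using that l by (simp add: vec_eq_iff forall_3 lf_def sum_3 mult.commute)
          qed (use less.prems(2)[of s 1] less.prems(3) st in auto)
        qed
        moreover have "l (vector [1, 0, 0]) \<noteq> 0 \<or> l (vector [0, 1, 0]) \<noteq> 0"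
          using l by (auto simp: lf_def sum_3)
        moreover have "linear_form l" using l linear_form_lf by (elim disjE) simp_all
        ultimately show ?thesis by blast
      qed
      then obtain h where h: "6 \<le> d" "form (d - 6) h" "\<exists>x. h x \<noteq> 0"
        "\<And>a m. vanishes m f a \<Longrightarrow> vanishes (m - length (filter (\<lambda>l. l a = 0) (map lf diagonal_lines))) h a"
        using divide_linear_forms[OF f nz _ sorted_lines(2)] unfolding len by blast
      have "h y = 0" for y
      proof (rule less.IH[OF _ h(2), of "i - 1" "j - 2" "k - 3"])
        show "d - 6 < d" using h(1) by simp
        show "vanishes (i - 1) h (vector [s, t, 0]) \<and> vanishes (i - 1) h (vector [s, 0, t]) \<and>
          vanishes (i - 1) h (vector [0, s, t])" if "s \<in> {1, -1}" "t \<in> {1, -1}" for s t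
          using h(4)[of i "vector [s, t, 0]"] h(4)[of i "vector [s, 0, t]"] h(4)[of i "vector [0, s, t]"]
            less.prems(2)[OF that] count_lines(8-10)[of 1, OF _ that] by simp
        show "vanishes (j - 2) h (vector [1, 0, 0])" "vanishes (j - 2) h (vector [0, 1, 0])"
          "vanishes (j - 2) h (vector [0, 0, 1])"
          using h(4)[OF less.prems(3)] h(4)[OF less.prems(4)] h(4)[OF less.prems(5)]
            count_lines(11-13)[of 1 1 1] by simp_all
        show "vanishes (k - 3) h (vector [r, s, t])" if "r \<in> {1, -1}" "s \<in> {1, -1}" "t \<in> {1, -1}" for r s t
          using h(4)[OF less.prems(6)[OF that]] count_lines(14)[OF that] by simp
        \<comment> \<open>Balanced because 6 * 6 = 12 * 1 + 3 * 2 + 6 * 3.\<close>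
        show "6 * (d - 6) < 12 * (i - 1) + 3 * (j - 2) + 6 * (k - 3)" using less.prems(7) h(1) by linarith
      qed
      with h(3) show False by blast
    qed
  qed
qed

text \<open>For each direction \<open>c\<close>, pull \<open>f\<close> back to the coordinates of
  \<open>a\<close>, \<open>b\<close>, \<open>c\<close>. While d < 3m, the line through the three
  points is a component of the resulting ternary form. Removing it lowers d and m by 1, hence 3m - d
  by 2, so it splits off (3m - d)/2 times, rounded up; the summand 2 in the hypothesis encodes the
  rounding.\<close>

lemma vanishes_on_A2_line:
  fixes f :: "complex ^ 'n \<Rightarrow> complex"
  assumes "form d f" "vanishes m f a" "vanishes m f b" "vanishes m f (a + b)" "d + 2 * s < 3 * m + 2"
  shows "vanishes s f (u *s a + v *s b)"
proof -
  have split: "\<exists>h. (\<forall>x. g x = x $ 3 ^ s * h x) \<and> (\<exists>e. form e h)"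
    if "form d g" "vanishes m g (vector [1, 0, 0])" "vanishes m g (vector [0, 1, 0])"
      "vanishes m g (vector [1, 1, 0])" "d + 2 * s < 3 * m + 2" for d m s and g :: "complex ^ 3 \<Rightarrow> complex"
    using that
  proof (induction s arbitrary: d m g)
    case 0
    then show ?case by auto
  next
    case (Suc s)
    show ?case
    proof (cases "\<exists>y. g y \<noteq> 0")
      case False
      then show ?thesis using form_zero by (intro exI[of _ "\<lambda>_. 0"]) auto
    next
      case True
      then obtain y where y: "g y \<noteq> 0" by blast
      let ?a = "vector [1, 0, 0] :: complex ^ 3" and ?b = "vector [0, 1, 0] :: complex ^ 3"
      have ab: "?a + ?b = vector [1, 1, 0]" by (simp add: vec_eq_iff forall_3)
      have d: "d < m + m + m" using Suc.prems(5) by presburger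
      have z: "g x = 0" if "x $ 3 = 0" for x
      proof -
        have "g (x $ 1 *s ?a + x $ 2 *s ?b) = 0"
          by (rule line3_vanish[OF Suc.prems(1-3) _ d]) (simp add: ab Suc.prems(4))
        moreover have "x $ 1 *s ?a + x $ 2 *s ?b = x" using that by (simp add: vec_eq_iff forall_3)
        ultimately show ?thesis by simp
      qed
      have l: "linear_form (\<lambda>x :: complex ^ 3. x $ 3)" by (rule linear_form_coord)
      have l1: "(vector [0, 0, 1] :: complex ^ 3) $ 3 \<noteq> 0" by simp
      obtain e h where h: "d = Suc e" "form e h" "\<And>x. g x = x $ 3 * h x"
        using form_divide_hyperplane[OF Suc.prems(1) l l1 z y] by blast
      have van: "vanishes (m - 1) h p" if "vanishes m g p" "p $ 3 = 0" for p
        using vanishes_divide[OF h(2) l l1, of m p] that unfolding h(3)[abs_def] by simp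
      have "e + 2 * s < 3 * (m - 1) + 2" using d Suc.prems(5) h(1) by simp
      then obtain k e' where "\<forall>x. h x = x $ 3 ^ s * k x" "form e' k"
        using Suc.IH[OF h(2) van[OF Suc.prems(2)] van[OF Suc.prems(3)] van[OF Suc.prems(4)]] by auto
      then show ?thesis using h(3) by (intro exI[of _ k]) auto
    qed
  qed
  show ?thesis
    unfolding vanishes_def
  proof
    fix c
    let ?g = "\<lambda>x :: complex ^ 3. x $ 1 *s a + x $ 2 *s b + x $ 3 *s c"
    have lin: "\<And>x y. ?g (x + y) = ?g x + ?g y" "\<And>k x. ?g (k *s x) = k *s ?g x"
      by (simp_all add: vec_eq_iff algebra_simps)
    have "form d (\<lambda>x. f (?g x))" using assms(1) lin by (rule form_compose)
    moreover have "vanishes m (\<lambda>x. f (?g x)) p" if "vanishes m f (?g p)" for p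
      using that lin by (rule vanishes_compose)
    ultimately obtain h e where h: "\<forall>x. f (?g x) = x $ 3 ^ s * h x" "form e h"
      using split[of d "\<lambda>x. f (?g x)" m s] assms by auto
    obtain p where p: "\<And>t. h (vector [u, v, 0] + t *s vector [0, 0, 1]) = poly p t"
      using form_line[OF h(2)] by blast
    have "f (u *s a + v *s b + t *s c) = t ^ s * poly p t" for t
      using h(1)[rule_format, of "vector [u, v, 0] + t *s vector [0, 0, 1]"] p[of t] by simp
    then show "\<exists>p. \<forall>t. f (u *s a + v *s b + t *s c) = t ^ s * poly p t" by blast
  qed
qed

section \<open>Integral vectors and the mirrors of \<open>F\<^sub>4\<close>\<close>

type_synonym int4 = "int \<times> int \<times> int \<times> int"

text \<open>Integer quadruples let the incidences be settled by evaluation. Passing through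
  \<open>vec4\<close> makes the points agree with the given representatives by unfolding.\<close>

fun cvec :: "int4 \<Rightarrow> complex ^ 4" where
  "cvec (a, b, c, d) = (\<chi> i. complex_of_real (vec4 (of_int a) (of_int b) (of_int c) (of_int d) $ i))"

lemma cvec_nth [simp]:
  "cvec (a, b, c, d) $ 1 = of_int a" "cvec (a, b, c, d) $ 2 = of_int b"
  "cvec (a, b, c, d) $ 3 = of_int c" "cvec (a, b, c, d) $ 4 = of_int d"
  by (simp_all add: vec4_nth)

declare cvec.simps [simp del]

fun dot :: "int4 \<Rightarrow> int4 \<Rightarrow> int" where
  "dot (a, b, c, d) (a', b', c', d') = a * a' + b * b' + c * c' + d * d'"

fun smul :: "int \<Rightarrow> int4 \<Rightarrow> int4" where
  "smul k (a, b, c, d) = (k * a, k * b, k * c, k * d)"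

fun add4 :: "int4 \<Rightarrow> int4 \<Rightarrow> int4" where
  "add4 (a, b, c, d) (a', b', c', d') = (a + a', b + b', c + c', d + d')"

lemma cvec_smul: "cvec (smul k p) = of_int k *s cvec p"
  by (cases p) (simp add: vec_eq_iff forall_4)

lemma cvec_add4: "cvec (add4 p q) = cvec p + cvec q"
  by (cases p; cases q) (simp add: vec_eq_iff forall_4)

lemma lf_cvec: "lf (cvec p) (cvec q) = of_int (dot p q)"
  by (cases p; cases q) (simp add: lf_def sum_4)

section \<open>Root lists and their incidences\<close>

definition D4_vecs :: "int4 list" where
  "D4_vecs = [(1,1,0,0), (1,0,1,0), (1,0,0,1), (1,0,0,-1), (1,0,-1,0), (1,-1,0,0),
    (0,1,1,0), (0,1,0,1), (0,1,0,-1), (0,1,-1,0), (0,0,1,1), (0,0,1,-1)]"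

definition coord_vecs :: "int4 list" where
  "coord_vecs = [(1,0,0,0), (0,1,0,0), (0,0,1,0), (0,0,0,1)]"

definition sign_vecs :: "int4 list" where
  "sign_vecs = [(1,1,1,1), (1,1,1,-1), (1,1,-1,1), (1,1,-1,-1),
    (1,-1,1,1), (1,-1,1,-1), (1,-1,-1,1), (1,-1,-1,-1)]"

definition F4_vecs :: "int4 list" where
  "F4_vecs = D4_vecs @ coord_vecs @ sign_vecs"

text \<open>The 24 points split into these six quadruples, three from \<open>coord_vecs\<close> and
  \<open>sign_vecs\<close>, three from \<open>D4_vecs\<close>. Hence each root heads exactly one
  flag, and \<open>map fst flags\<close> lists every mirror once.\<close>

definition frames :: "(int4 \<times> int4 \<times> int4 \<times> int4) list" where
  "frames =
    [((1,0,0,0), (0,1,0,0), (0,0,1,0), (0,0,0,1)),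
     ((1,1,1,1), (1,1,-1,-1), (1,-1,1,-1), (1,-1,-1,1)),
     ((1,1,1,-1), (1,1,-1,1), (1,-1,1,1), (1,-1,-1,-1)),
     ((1,1,0,0), (1,-1,0,0), (0,0,1,1), (0,0,1,-1)),
     ((1,0,1,0), (1,0,-1,0), (0,1,0,1), (0,1,0,-1)),
     ((1,0,0,1), (1,0,0,-1), (0,1,1,0), (0,1,-1,0))]"

text \<open>A frame is an orthogonal quadruple of roots. The mirror of the first root \<open>r\<close> of a flag
  \<open>(r, u, v, w)\<close> carries the \<open>B\<^sub>3\<close> configuration with coordinates \<open>u, v, w\<close>; its points
  \<open>\<plusminus>u \<plusminus> v \<plusminus> w\<close> are not roots but lie on lines through \<open>r\<close> and two further roots.\<close>

fun rotations :: "'a \<times> 'a \<times> 'a \<times> 'a \<Rightarrow> ('a \<times> 'a \<times> 'a \<times> 'a) list" where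
  "rotations (a, b, c, d) = [(a, b, c, d), (b, a, c, d), (c, a, b, d), (d, a, b, c)]"

definition flags :: "(int4 \<times> int4 \<times> int4 \<times> int4) list" where
  "flags = concat (map rotations frames)"

text \<open>As every listed vector has leading coefficient 1, the scalar is read off.\<close>

fun on_points :: "int4 list \<Rightarrow> int4 \<Rightarrow> bool" where
  "on_points ps (a, b, c, d) \<longleftrightarrow>
    (let k = (if a \<noteq> 0 then a else if b \<noteq> 0 then b else if c \<noteq> 0 then c else d)
     in k \<noteq> 0 \<and> list_ex (\<lambda>p. (a, b, c, d) = smul k p) ps)"

lemma vanishes_on_points:
  assumes "form d f" "\<And>p. p \<in> set ps \<Longrightarrow> vanishes m f (cvec p)" "on_points ps v"
  shows "vanishes m f (cvec v)"
proof -
  obtain k p where "k \<noteq> 0" "p \<in> set ps" "v = smul k p"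
    using assms(3) by (cases v) (auto simp: Let_def list_ex_iff)
  then show ?thesis using vanishes_scale[OF assms(1) assms(2)] by (simp add: cvec_smul)
qed

fun plane_D3 :: "int4 \<times> int4 \<times> int4 \<times> int4 \<Rightarrow> int4 list" where
  "plane_D3 (r, u, v, w) = [add4 (smul s a) (smul t b).
    (a, b) \<leftarrow> [(u, v), (u, w), (v, w)], s \<leftarrow> [1, -1], t \<leftarrow> [1, -1]]"

text \<open>For y = \<plusminus>u \<plusminus> v \<plusminus> w these are the roots r + y. The list
  is closed under the change of y to -y, so it also contains the second root r - y on the line
  through r and y.\<close>

fun plane_A2 :: "int4 \<times> int4 \<times> int4 \<times> int4 \<Rightarrow> int4 list" where
  "plane_A2 (r, u, v, w) = [add4 r (add4 (smul k u) (add4 (smul s v) (smul t w))).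
    k \<leftarrow> [1, -1], s \<leftarrow> [1, -1], t \<leftarrow> [1, -1]]"

lemma flags_F4:
  "list_all (\<lambda>(r, u, v, w). list_all (on_points F4_vecs)
    ([r, u, v, w] @ plane_D3 (r, u, v, w) @ plane_A2 (r, u, v, w))) flags"
  by code_simp

lemma flags_D4: "list_all (\<lambda>q. list_all (on_points D4_vecs) (plane_D3 q)) (rotations (hd frames))"
  by code_simp

text \<open>The roots orthogonal to a given root of \<open>F\<^sub>4\<close> form a system of type
  \<open>B\<^sub>3\<close> or \<open>C\<^sub>3\<close>, which has nine positive roots.\<close>

lemma mirrors_count: "list_all (\<lambda>p. length (filter (\<lambda>r. dot r p = 0) (map fst flags)) = 9) F4_vecs"
  by code_simp

text \<open>A coordinate point lies on three of the planes, whence the inequality. The descent runs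
  on the \<open>D\<^sub>4\<close> points, where the count is constant.\<close>

lemma coord_count: "list_all (\<lambda>p. length (filter (\<lambda>r. dot r p = 0) coord_vecs) \<ge> 2) (D4_vecs @ coord_vecs)"
  "list_all (\<lambda>p. length (filter (\<lambda>r. dot r p = 0) coord_vecs) = 2) D4_vecs"
  by code_simp+

definition independent_forms :: "int4 list \<Rightarrow> bool" where
  "independent_forms ls \<longleftrightarrow> list_all (\<lambda>p. dot p p \<noteq> 0) ls \<and>
    sorted_wrt (\<lambda>p q. dot p p * dot q q \<noteq> (dot p q)\<^sup>2) ls"

lemma independent_mirrors: "independent_forms (map fst flags)"
  by code_simp

lemma independent_coords: "independent_forms coord_vecs"
  by code_simp

section \<open>Forms vanishing at the points of \<open>D\<^sub>4\<close> and \<open>F\<^sub>4\<close>\<close>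

lemma mirror_arrangement_bound:
  assumes ls: "independent_forms ls" "ls \<noteq> []"
    and count: "\<And>p. p \<in> set ps \<Longrightarrow> length (filter (\<lambda>r. dot r p = 0) ls) = q"
    and ratio: "q * A \<le> length ls * B"
    and mirror: "\<And>d f m l x. form d f \<Longrightarrow> (\<And>p. p \<in> set ps \<Longrightarrow> vanishes m f (cvec p)) \<Longrightarrow>
      d * B < m * A \<Longrightarrow> l \<in> set ls \<Longrightarrow> lf (cvec l) x = 0 \<Longrightarrow> f x = 0"
    and "form d f" "\<And>p. p \<in> set ps \<Longrightarrow> vanishes m f (cvec p)" "d * B < m * A"
  shows "f x = 0"
  using assms(6-8)
proof (induction d arbitrary: f m x rule: less_induct)
  case (less d f m x)
  show ?case
  proof (rule ccontr)
    assume nz: "f x \<noteq> 0"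
    have l: "linear_form k \<and> (\<exists>v. k v \<noteq> 0) \<and> (\<forall>x. k x = 0 \<longrightarrow> f x = 0)"
      if k: "k \<in> set (map (\<lambda>l. lf (cvec l)) ls)" for k
    proof -
      from k obtain l where l: "l \<in> set ls" "k = lf (cvec l)" by auto
      have "k (cvec l) \<noteq> 0" using l ls(1) by (auto simp: independent_forms_def lf_cvec list_all_iff)
      moreover have "\<forall>x. k x = 0 \<longrightarrow> f x = 0"
        using mirror[OF less.prems(1,2,3) l(1)] l(2) by blast
      moreover have "linear_form k" unfolding l(2) by (rule linear_form_lf)
      ultimately show ?thesis by blast
    qed
    have s: "sorted_wrt (\<lambda>l l'. \<exists>x. l' x = 0 \<and> l x \<noteq> 0) (map (\<lambda>l. lf (cvec l)) ls)"
      unfolding sorted_wrt_map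
    proof (rule sorted_wrt_mono_rel[of _ "\<lambda>p q. dot p p * dot q q \<noteq> (dot p q)\<^sup>2"])
      show "\<exists>x. lf (cvec q) x = 0 \<and> lf (cvec p) x \<noteq> 0" if "dot p p * dot q q \<noteq> (dot p q)\<^sup>2" for p q
        using that by (intro lf_independent) (simp add: lf_cvec flip: of_int_mult of_int_power)
      show "sorted_wrt (\<lambda>p q. dot p p * dot q q \<noteq> (dot p q)\<^sup>2) ls"
        using ls(1) by (simp add: independent_forms_def)
    qed
    obtain h where h: "length ls \<le> d" "form (d - length ls) h" "\<exists>x. h x \<noteq> 0"
      "\<And>a m. vanishes m f a \<Longrightarrow>
        vanishes (m - length (filter (\<lambda>l. l a = 0) (map (\<lambda>l. lf (cvec l)) ls))) h a"
      using divide_linear_forms[OF less.prems(1) nz l s] unfolding length_map by blast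
    have "vanishes (m - q) h (cvec p)" if p: "p \<in> set ps" for p
      using h(4)[OF less.prems(2)[OF p]] count[OF p] by (simp add: filter_map o_def lf_cvec)
    \<comment> \<open>The chain \<open>q * A \<le> length ls * B \<le> d * B < m * A\<close> keeps
      the subtractions from truncating.\<close>
    moreover have "(d - length ls) * B < (m - q) * A"
    proof -
      have "(d - length ls) * B = d * B - length ls * B" by (rule diff_mult_distrib)
      also have "\<dots> < m * A - q * A"
        using less.prems(3) ratio h(1) mult_le_mono1[OF h(1), of B] by linarith
      finally show ?thesis by (simp add: diff_mult_distrib)
    qed
    moreover have "d - length ls < d" using ls(2) h(1) by (cases ls) auto
    ultimately have "h y = 0" for y using less.IH[OF _ h(2)] by blast
    with h(3) show False by blast
  qed
qed

text \<open>The first hypothesis is the resolution of the identity by an orthogonal basis of common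
  norm \<open>n\<close>, written entrywise. Summed against \<open>x\<close> it gives the expansion
  of \<open>x\<close>, whose \<open>r\<close> term drops out on the mirror.\<close>

lemma mirror_coordinates:
  fixes r u v w x :: "complex ^ 'n"
  assumes "\<And>i j. r $ i * r $ j + u $ i * u $ j + v $ i * v $ j + w $ i * w $ j = (if i = j then n else 0)"
    and "n \<noteq> 0" "lf r x = 0"
  shows "x = (lf u x / n) *s u + (lf v x / n) *s v + (lf w x / n) *s w"
proof -
  have "n * x $ i = u $ i * lf u x + v $ i * lf v x + w $ i * lf w x" for i
  proof -
    have "n * x $ i = (\<Sum>j\<in>UNIV. (if i = j then n else 0) * x $ j)"
      by (simp add: if_distrib[of "\<lambda>t. t * _"] cong: if_cong)
    also have "\<dots> = (\<Sum>j\<in>UNIV. (r $ i * r $ j + u $ i * u $ j + v $ i * v $ j + w $ i * w $ j) * x $ j)"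
      unfolding assms(1) ..
    also have "\<dots> = r $ i * lf r x + u $ i * lf u x + v $ i * lf v x + w $ i * lf w x"
      by (simp add: lf_def sum_distrib_left sum.distrib algebra_simps)
    finally show ?thesis using assms(3) by simp
  qed
  then show ?thesis using assms(2) by (simp add: vec_eq_iff field_simps)
qed

lemma flags_gram:
  assumes "(r, u, v, w) \<in> set flags"
  shows "cvec r $ i * cvec r $ j + cvec u $ i * cvec u $ j + cvec v $ i * cvec v $ j + cvec w $ i * cvec w $ j
    = (if i = j then of_int (dot r r) else 0)"
proof -
  have "\<forall>i j. cvec r $ i * cvec r $ j + cvec u $ i * cvec u $ j + cvec v $ i * cvec v $ j + cvec w $ i * cvec w $ j
    = (if i = j then of_int (dot r r) else 0)"
    using assms unfolding flags_def frames_def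
    by (simp only: list.map concat.simps rotations.simps append.simps set_simps insert_iff empty_iff prod.inject)
      (elim disjE conjE FalseE; simp only: forall_4 cvec_nth; simp)
  then show ?thesis by blast
qed

lemma plane_restriction:
  fixes f :: "complex ^ 'n \<Rightarrow> complex" and u v w :: "complex ^ 'n"
  assumes f: "form d f"
    and D3: "\<And>a b s t. (a, b) \<in> {(u, v), (u, w), (v, w)} \<Longrightarrow> s \<in> {1, -1} \<Longrightarrow> t \<in> {1, -1} \<Longrightarrow>
      vanishes i f (s *s a + t *s b)"
    and coord: "vanishes j f u" "vanishes j f v" "vanishes j f w"
    and A2: "\<And>k' s t. k' \<in> {1, -1} \<Longrightarrow> s \<in> {1, -1} \<Longrightarrow> t \<in> {1, -1} \<Longrightarrow>
      vanishes k f (k' *s u + s *s v + t *s w)"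
    and d: "6 * d < 12 * i + 3 * j + 6 * k"
  shows "f (x *s u + y *s v + z *s w) = 0"
proof -
  let ?g = "\<lambda>x :: complex ^ 3. x $ 1 *s u + x $ 2 *s v + x $ 3 *s w"
  have lin: "\<And>x y. ?g (x + y) = ?g x + ?g y" "\<And>k x. ?g (k *s x) = k *s ?g x"
    by (simp_all add: vec_eq_iff algebra_simps)
  have van: "vanishes m (\<lambda>x. f (?g x)) p" if "vanishes m f (?g p)" for m p
    using that lin by (rule vanishes_compose)
  have "f (?g (vector [x, y, z])) = 0"
  proof (rule B3_vanish[OF form_compose[OF f, of ?g, OF lin] _ _ _ _ _ d])
    show "vanishes i (\<lambda>x. f (?g x)) (vector [s, t, 0]) \<and> vanishes i (\<lambda>x. f (?g x)) (vector [s, 0, t]) \<and>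
        vanishes i (\<lambda>x. f (?g x)) (vector [0, s, t])" if "s \<in> {1, -1}" "t \<in> {1, -1}" for s t
      using D3[of u v, OF _ that] D3[of u w, OF _ that] D3[of v w, OF _ that]
      by (intro conjI van) simp_all
    show "vanishes k (\<lambda>x. f (?g x)) (vector [r, s, t])" if "r \<in> {1, -1}" "s \<in> {1, -1}" "t \<in> {1, -1}" for r s t
      using A2[OF that] by (intro van) simp
  qed (use coord in \<open>intro van; simp\<close>)+
  then show ?thesis by simp
qed

lemma plane_D3_mem:
  assumes "(a, b) \<in> {(cvec u, cvec v), (cvec u, cvec w), (cvec v, cvec w)}" "s \<in> {1, -1}" "t \<in> {1, -1}"
  shows "\<exists>p\<in>set (plane_D3 (r, u, v, w)). s *s a + t *s b = cvec p"
  using assms by (auto simp: cvec_add4 cvec_smul)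

lemma plane_A2_mem:
  assumes "k \<in> {1, -1}" "s \<in> {1, -1}" "t \<in> {1, -1}"
  shows "\<exists>p\<in>set (plane_A2 (r, u, v, w)). cvec r + (k *s cvec u + s *s cvec v + t *s cvec w) = cvec p"
  using assms by (auto simp: cvec_add4 cvec_smul algebra_simps)

lemma D4_vanish:
  assumes "form d f" "\<And>p. p \<in> set D4_vecs \<Longrightarrow> vanishes m f (cvec p)" "d < 2 * m"
  shows "f x = 0"
proof (rule mirror_arrangement_bound[OF independent_coords _ _ _ _ assms(1,2), where A = 2 and B = 1 and q = 2])
  fix d f m l x
  assume f: "form d f" and v: "\<And>p. p \<in> set D4_vecs \<Longrightarrow> vanishes m f (cvec p)" and d: "d * 1 < m * 2"
    and l: "l \<in> set coord_vecs" and x: "lf (cvec l) x = 0"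
  from l obtain u v w where q: "(l, u, v, w) \<in> set (rotations (hd frames))"
    by (auto simp: coord_vecs_def frames_def)
  then have fl: "(l, u, v, w) \<in> set flags" by (auto simp: flags_def frames_def)
  have plane: "f (a *s cvec u + b *s cvec v + c *s cvec w) = 0" for a b c
  proof (rule plane_restriction[OF f, of _ _ _ m 0 0])
    show "vanishes m f (s *s a + t *s b)"
      if ab: "(a, b) \<in> {(cvec u, cvec v), (cvec u, cvec w), (cvec v, cvec w)}" "s \<in> {1, -1}" "t \<in> {1, -1}" for a b s t
    proof -
      obtain p where "p \<in> set (plane_D3 (l, u, v, w))" "s *s a + t *s b = cvec p"
        using plane_D3_mem[OF ab, where r = l] by blast
      then show ?thesis
        using vanishes_on_points[OF f v] flags_D4 q by (simp add: list_all_iff del: plane_D3.simps)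
    qed
    show "6 * d < 12 * m + 3 * 0 + 6 * 0" using d by simp
  qed (rule vanishes_0[OF f])+
  have "dot l l \<noteq> 0" using l by (auto simp: coord_vecs_def)
  then have "(of_int (dot l l) :: complex) \<noteq> 0" by simp
  note xe = mirror_coordinates[OF flags_gram[OF fl] this x]
  show "f x = 0" by (subst xe) (rule plane)
qed (use assms(3) coord_count(2) in \<open>auto simp: list_all_iff coord_vecs_def\<close>)

lemma F4_vanish:
  assumes "form d f" "\<And>p. p \<in> set F4_vecs \<Longrightarrow> vanishes m f (cvec p)" "3 * d < 8 * m"
  shows "f x = 0"
proof (rule mirror_arrangement_bound[OF independent_mirrors _ _ _ _ assms(1,2), where A = 8 and B = 3 and q = 9])
  fix d f m l x
  assume f: "form d f" and v: "\<And>p. p \<in> set F4_vecs \<Longrightarrow> vanishes m f (cvec p)" and d: "d * 3 < m * 8"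
    and l: "l \<in> set (map fst flags)" and x: "lf (cvec l) x = 0"
  from l obtain u v w where fl: "(l, u, v, w) \<in> set flags" by auto
  have "list_all (on_points F4_vecs) ([l, u, v, w] @ plane_D3 (l, u, v, w) @ plane_A2 (l, u, v, w))"
    using flags_F4 fl by (auto simp only: list_all_iff dest!: bspec)
  then have on: "on_points F4_vecs p"
    if "p \<in> set ([l, u, v, w] @ plane_D3 (l, u, v, w) @ plane_A2 (l, u, v, w))" for p
    using that unfolding list_all_iff by (rule bspec)
  have pts: "vanishes m f (cvec p)"
    if "p \<in> set ([l, u, v, w] @ plane_D3 (l, u, v, w) @ plane_A2 (l, u, v, w))" for p
    using vanishes_on_points[OF f v on[OF that]] .
  have D3: "vanishes m f (cvec p)" if "p \<in> set (plane_D3 (l, u, v, w))" for p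
    using that by (intro pts) (simp only: set_append Un_iff simp_thms)
  have A2: "vanishes m f (cvec p)" if "p \<in> set (plane_A2 (l, u, v, w))" for p
    using that by (intro pts) (simp only: set_append Un_iff simp_thms)
  have frame: "vanishes m f (cvec p)" if "p \<in> set [l, u, v, w]" for p
    using that by (intro pts) (simp only: set_append Un_iff simp_thms)
  \<comment> \<open>\<open>n\<close> is (3m - d)/2 rounded up: the first bound admits it in
    \<open>vanishes_on_A2_line\<close>, the second is the gain used in the plane.\<close>
  obtain n where n: "d + 2 * n < 3 * m + 2" "3 * m \<le> d + 2 * n"
  proof -
    have "d \<le> 3 * m" using d by linarith
    then obtain k where k: "3 * m = d + k" using le_Suc_ex by blast
    have "2 * ((k + 1) div 2) < k + 2" "k \<le> 2 * ((k + 1) div 2)" by linarith+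
    then show ?thesis using k by (intro that[of "(k + 1) div 2"]) linarith+
  qed
  have plane: "f (a *s cvec u + b *s cvec v + c *s cvec w) = 0" for a b c
  proof (rule plane_restriction[OF f, of _ _ _ m m n])
    show "vanishes m f (s *s a + t *s b)"
      if ab: "(a, b) \<in> {(cvec u, cvec v), (cvec u, cvec w), (cvec v, cvec w)}" "s \<in> {1, -1}" "t \<in> {1, -1}" for a b s t
    proof -
      obtain p where "p \<in> set (plane_D3 (l, u, v, w))" "s *s a + t *s b = cvec p"
        using plane_D3_mem[OF ab, where r = l] by blast
      then show ?thesis using D3 by (simp only:)
    qed
    show "vanishes n f (k *s cvec u + s *s cvec v + t *s cvec w)"
      if k: "k \<in> {1, -1}" "s \<in> {1, -1}" "t \<in> {1, -1}" for k s t
    proof -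
      \<comment> \<open>\<open>y\<close> is not a root. It lies on the line through the roots
        \<open>l + y\<close> and \<open>l - y\<close>, whose sum is the multiple
        \<open>2 * l\<close> of a third root.\<close>
      define y where "y = k *s cvec u + s *s cvec v + t *s cvec w"
      have neg: "- k \<in> {1, -1}" "- s \<in> {1, -1}" "- t \<in> {1, -1}" using k by auto
      have my: "- k *s cvec u + - s *s cvec v + - t *s cvec w = - y"
        by (simp add: y_def vec_eq_iff)
      have 1: "vanishes m f (cvec l + y)"
        using plane_A2_mem[OF k, where r = l and u = u and v = v and w = w]
        unfolding y_def by (elim bexE) (simp only: A2)
      have 2: "vanishes m f (cvec l + - y)"
        using plane_A2_mem[OF neg, where r = l and u = u and v = v and w = w]
        unfolding my by (elim bexE) (simp only: A2)
      have eq: "(cvec l + y) + (cvec l + - y) = 2 *s cvec l"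
        "(1/2) *s (cvec l + y) + (- (1/2)) *s (cvec l + - y) = y"
        by (simp_all add: vec_eq_iff field_simps)
      have "vanishes m f (2 *s cvec l)"
        by (rule vanishes_scale[OF f frame]) simp_all
      then have 3: "vanishes m f ((cvec l + y) + (cvec l + - y))" unfolding eq .
      show ?thesis
        using vanishes_on_A2_line[OF f 1 2 3 n(1), of "1/2" "- (1/2)"] unfolding eq(2) unfolding y_def .
    qed
    \<comment> \<open>Since 6n \<ge> 9m - 3d, the right side is at least 24m - 3d, which exceeds 6d
      exactly when 3d < 8m.\<close>
    show "6 * d < 12 * m + 3 * m + 6 * n" using d n(2) by linarith
  qed (rule frame; simp)+
  have "dot l l \<noteq> 0"
    using l independent_mirrors unfolding independent_forms_def list_all_iff by blast
  then have "(of_int (dot l l) :: complex) \<noteq> 0" by simp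
  note xe = mirror_coordinates[OF flags_gram[OF fl] this x]
  show "f x = 0" by (subst xe) (rule plane)
next
  show "map fst flags \<noteq> []" "9 * 8 \<le> length (map fst flags) * 3" by (simp_all add: flags_def frames_def)
  show "length (filter (\<lambda>r. dot r p = 0) (map fst flags)) = 9" if "p \<in> set F4_vecs" for p
    using mirrors_count that unfolding list_all_iff by blast
  show "d * 3 < m * 8" using assms(3) by linarith
qed

section \<open>Polynomials as forms\<close>

lemma mpol_induct [case_names zero add]:
  assumes "P 0" "\<And>f a c. P f \<Longrightarrow> P (f + Poly_Mapping.single a c)"
  shows "P (f :: 'a \<Rightarrow>\<^sub>0 'b::comm_monoid_add)"
proof (induction f rule: update_induct)
  case const
  show ?case by (rule assms(1))
next
  case (update f a c)
  have "Poly_Mapping.update a c f = f + Poly_Mapping.single a c"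
    using update(1) by (intro poly_mapping_eqI) (auto simp: lookup_update lookup_add lookup_single in_keys_iff)
  then show ?case using assms(2)[OF update(3)] by simp
qed

lemma eval_mpol_superset:
  assumes "finite A" "Poly_Mapping.keys f \<subseteq> A"
  shows "eval_mpol x f = (\<Sum>a\<in>A. Poly_Mapping.lookup f a * (\<Prod>i\<in>UNIV. (x $ i) ^ Poly_Mapping.lookup a i))"
  unfolding eval_mpol_def using assms by (intro sum.mono_neutral_left) (auto simp: in_keys_iff)

lemma eval_mpol_zero [simp]: "eval_mpol x 0 = 0"
  by (simp add: eval_mpol_def)

lemma eval_mpol_single:
  "eval_mpol x (Poly_Mapping.single a c) = c * (\<Prod>i\<in>UNIV. (x $ i) ^ Poly_Mapping.lookup a i)"
  by (subst eval_mpol_superset[of "{a}"]) auto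

lemma eval_mpol_add: "eval_mpol x (f + g) = eval_mpol x f + eval_mpol x g"
proof -
  let ?A = "Poly_Mapping.keys f \<union> Poly_Mapping.keys g"
  show ?thesis
    using keys_add[of f g]
    by (simp add: eval_mpol_superset[of ?A] lookup_add ring_distribs sum.distrib)
qed

lemma eval_mpol_mult: "eval_mpol x (f * g) = eval_mpol x f * eval_mpol x (g :: ('n::finite) mpol)"
proof (induction f rule: mpol_induct)
  case (add f a c)
  have "eval_mpol x (Poly_Mapping.single a c * g) = eval_mpol x (Poly_Mapping.single a c) * eval_mpol x g"
    by (induction g rule: mpol_induct)
      (simp_all add: ring_distribs eval_mpol_add mult_single eval_mpol_single lookup_add power_add prod.distrib)
  with add show ?case by (simp add: ring_distribs eval_mpol_add)
qed simp

lemma eval_mpol_one [simp]: "eval_mpol x 1 = 1"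
  using eval_mpol_single[of x 0 1] by simp

lemma eval_mpol_prod_list: "eval_mpol x (prod_list fs) = prod_list (map (eval_mpol x) (fs :: ('n::finite) mpol list))"
  by (induction fs) (simp_all add: eval_mpol_mult)

lemma form_monomial:
  "form (\<Sum>i\<in>UNIV. Poly_Mapping.lookup a i) (\<lambda>x. c * (\<Prod>i\<in>UNIV. (x $ i) ^ Poly_Mapping.lookup a (i::'n::finite)))"
  by (rule form_scale, rule form_prod) (simp_all add: form_power_coord)

lemma form_eval_mpol:
  assumes "homogeneous d f"
  shows "form d (\<lambda>x. eval_mpol x f)"
  unfolding eval_mpol_def
proof (rule form_sum)
  fix a assume "a \<in> Poly_Mapping.keys f"
  then have "(\<Sum>i\<in>UNIV. Poly_Mapping.lookup a i) = d" using assms by (simp add: homogeneous_def)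
  then show "form d (\<lambda>x. Poly_Mapping.lookup f a * (\<Prod>i\<in>UNIV. (x $ i) ^ Poly_Mapping.lookup a i))"
    using form_monomial[of a] by blast
qed

text \<open>The multipliers in an ideal are arbitrary polynomials, not forms, so the claim is
  assembled from monomials.\<close>

lemma vanishes_0_eval_mpol: "vanishes 0 (\<lambda>x. eval_mpol x f) a"
proof (induction f rule: mpol_induct)
  case zero
  show ?case using vanishes_0[OF form.const] by simp
next
  case (add f b c)
  show ?case
    unfolding eval_mpol_add eval_mpol_single
    by (rule vanishes_add[OF add vanishes_0[OF form_monomial]])
qed

lemma vanishes_1_eval_mpol:
  assumes "eval_mpol a f = 0"
  shows "vanishes 1 (\<lambda>x. eval_mpol x f) a"
  unfolding vanishes_def
proof
  fix b
  obtain p where p: "\<And>t. eval_mpol (a + t *s b) f = t ^ 0 * poly p t"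
    using vanishesE[OF vanishes_0_eval_mpol] by blast
  have "poly p 0 = 0" using p[of 0] assms by simp
  then obtain q where "p = [:0, 1:] * q" using poly_eq_0_iff_dvd[of p 0] by (auto elim: dvdE)
  then show "\<exists>p. \<forall>t. eval_mpol (a + t *s b) f = t ^ 1 * poly p t"
    using p by (intro exI[of _ q]) simp
qed

text \<open>Kronecker substitution: evaluation at \<open>(t, t\<^sup>N, t\<^sup>N\<^sup>2, t\<^sup>N\<^sup>3)\<close> separates the monomials.\<close>

lemma mpol_eval_nonzero:
  fixes f :: "4 mpol"
  assumes "f \<noteq> 0"
  shows "\<exists>x. eval_mpol x f \<noteq> 0"
proof -
  let ?K = "Poly_Mapping.keys f"
  let ?l = Poly_Mapping.lookup
  \<comment> \<open>\<open>N\<close> exceeds every exponent that occurs, so the exponents of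
    \<open>a\<close> are the base \<open>N\<close> digits of \<open>e a\<close>.\<close>
  define N where "N = Suc (\<Sum>a\<in>?K. \<Sum>i\<in>UNIV. ?l a i)"
  have N: "?l a i < N" if "a \<in> ?K" for a i
  proof -
    have "?l a i \<le> (\<Sum>i\<in>UNIV. ?l a i)" by (rule member_le_sum) auto
    also have "\<dots> \<le> (\<Sum>a\<in>?K. \<Sum>i\<in>UNIV. ?l a i)" using that by (intro member_le_sum) auto
    finally show ?thesis by (simp add: N_def)
  qed
  define e where "e a = ?l a 1 + N * (?l a 2 + N * (?l a 3 + N * ?l a 4))" for a :: "4 \<Rightarrow>\<^sub>0 nat"
  have digit: "x = x' \<and> y = y'" if "x + N * y = x' + N * y'" "x < N" "x' < N" for x x' y y' :: nat
  proof -
    have "x = x'" using arg_cong[OF that(1), of "\<lambda>z. z mod N"] that(2,3) by simp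
    with that show ?thesis by simp
  qed
  have inj: "a = b" if ab: "a \<in> ?K" "b \<in> ?K" "e a = e b" for a b
  proof -
    note d = N[OF ab(1)] N[OF ab(2)]
    have 1: "?l a 1 = ?l b 1" "?l a 2 + N * (?l a 3 + N * ?l a 4) = ?l b 2 + N * (?l b 3 + N * ?l b 4)"
      using digit[OF ab(3)[unfolded e_def]] d by auto
    have 2: "?l a 2 = ?l b 2" "?l a 3 + N * ?l a 4 = ?l b 3 + N * ?l b 4"
      using digit[OF 1(2)] d by auto
    have 3: "?l a 3 = ?l b 3" "?l a 4 = ?l b 4"
      using digit[OF 2(2)] d by auto
    have "\<forall>i. ?l a i = ?l b i" unfolding forall_4 using 1 2 3 by simp
    then show ?thesis by (intro poly_mapping_eqI) simp
  qed
  define p where "p = (\<Sum>a\<in>?K. monom (?l f a) (e a))"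
  obtain b where b: "b \<in> ?K" using assms by (metis all_not_in_conv keys_eq_empty)
  have "coeff p (e b) = (\<Sum>a\<in>?K. if a = b then ?l f a else 0)"
    unfolding p_def coeff_sum
  proof (rule sum.cong)
    show "coeff (monom (?l f a) (e a)) (e b) = (if a = b then ?l f a else 0)" if "a \<in> ?K" for a
      using inj[OF that b] by (cases "a = b") auto
  qed simp
  also have "\<dots> = ?l f b" using b by simp
  finally have "p \<noteq> 0" using b by (auto simp: in_keys_iff)
  then obtain t where t: "poly p t \<noteq> 0" using poly_zero_cofinite[of 0 p] by blast
  define x :: "complex ^ 4" where "x = (\<chi> i. t ^ (if i = 1 then 1 else if i = 2 then N else if i = 3 then N * N else N * (N * N)))"
  have "eval_mpol x f = poly p t"
    unfolding eval_mpol_def p_def poly_sum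
  proof (rule sum.cong)
    fix a
    have "(\<Prod>i\<in>UNIV. (x $ i) ^ ?l a i) = t ^ e a"
    proof -
      have "(\<Prod>i\<in>UNIV. g i) = g 1 * g 2 * g 3 * g 4" for g :: "4 \<Rightarrow> complex"
        unfolding UNIV_4 by simp
      then have "(\<Prod>i\<in>UNIV. (x $ i) ^ ?l a i) =
          t ^ ?l a 1 * (t ^ N) ^ ?l a 2 * (t ^ (N * N)) ^ ?l a 3 * (t ^ (N * (N * N))) ^ ?l a 4"
        by (simp add: x_def)
      then show ?thesis by (simp add: e_def distrib_left power_add power_mult)
    qed
    then show "?l f a * (\<Prod>i\<in>UNIV. (x $ i) ^ ?l a i) = poly (monom (?l f a) (e a)) t"
      by (simp add: poly_monom)
  qed simp
  with t show ?thesis by metis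
qed

section \<open>Symbolic powers\<close>

lemma module_mult: "module ((*) :: 'a::comm_ring_1 \<Rightarrow> 'a \<Rightarrow> 'a)"
  by unfold_locales (simp_all add: algebra_simps)

lemma ideal_pow_subspace: "module.subspace (*) (ideal_pow J m)"
  by (cases m) (simp_all add: ideal_gen_def module.subspace_span[OF module_mult] module.subspace_UNIV[OF module_mult])

lemma ideal_pow_scale: "f \<in> ideal_pow J m \<Longrightarrow> r * f \<in> ideal_pow J m"
  using module.subspace_scale[OF module_mult ideal_pow_subspace] .

lemma ideal_pow_mult: "f \<in> J \<Longrightarrow> g \<in> ideal_pow J m \<Longrightarrow> f * g \<in> ideal_pow J (Suc m)"
  unfolding ideal_pow.simps ideal_gen_def by (rule module.span_base[OF module_mult]) blast

lemma ideal_pow_Suc_subset: "ideal_pow J (Suc m) \<subseteq> ideal_pow J m"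
  unfolding ideal_pow.simps(2) ideal_gen_def
  by (rule module.span_minimal[OF module_mult _ ideal_pow_subspace]) (auto intro: ideal_pow_scale)

lemma ideal_pow_antimono: "k \<le> m \<Longrightarrow> ideal_pow J m \<subseteq> ideal_pow J k"
  by (rule lift_Suc_antimono_le[of "ideal_pow J"]) (rule ideal_pow_Suc_subset)

text \<open>Factors that fail \<open>P\<close> are absorbed as multipliers, so only those satisfying
  \<open>P\<close> are counted in the exponent.\<close>

lemma prod_list_ideal_pow:
  assumes "\<And>f. f \<in> set fs \<Longrightarrow> P f \<Longrightarrow> f \<in> J"
  shows "prod_list fs \<in> ideal_pow J (length (filter P fs))"
  using assms by (induction fs) (auto intro: ideal_pow_mult ideal_pow_scale simp del: ideal_pow.simps(2))

lemma eval_point_ideal: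
  assumes "f \<in> point_ideal (proj_pt v)"
  shows "eval_mpol v f = 0"
proof -
  have v: "v \<in> proj_pt v" unfolding proj_pt_def by (auto intro!: exI[of _ 1])
  from assms show ?thesis
    unfolding point_ideal_def ideal_gen_def
    by (rule module.span_induct_alt[OF module_mult])
      (use v in \<open>auto simp: eval_mpol_add eval_mpol_mult\<close>)
qed

text \<open>The passage from symbolic powers to multiplicities, for the lower bounds. A generator of
  the next power is a product whose first factor vanishes at \<open>v\<close>, and multiplicities
  add.\<close>

lemma vanishes_ideal_pow:
  assumes "f \<in> ideal_pow (point_ideal (proj_pt v)) m"
  shows "vanishes m (\<lambda>x. eval_mpol x f) v"
  using assms
proof (induction m arbitrary: f)
  case 0
  show ?case by (rule vanishes_0_eval_mpol)
next
  case (Suc m)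
  from Suc.prems show ?case
    unfolding ideal_pow.simps ideal_gen_def
  proof (induction rule: module.span_induct_alt[OF module_mult, consumes 1, case_names base step])
    case base
    have "vanishes (Suc m) (\<lambda>_. 0) v" unfolding vanishes_def by (auto intro: exI[of _ 0])
    then show ?case by simp
  next
    case (step c f g)
    from step(1) obtain h k where hk: "f = h * k" "h \<in> point_ideal (proj_pt v)" "k \<in> ideal_pow (point_ideal (proj_pt v)) m"
      by blast
    have "vanishes (0 + (1 + m)) (\<lambda>x. eval_mpol x c * (eval_mpol x h * eval_mpol x k)) v"
      using Suc.IH[OF hk(3)] vanishes_1_eval_mpol[OF eval_point_ideal[OF hk(2)]]
      by (intro vanishes_mult vanishes_0_eval_mpol)
    then show ?case
      using vanishes_add[OF _ step(2)] unfolding eval_mpol_add eval_mpol_mult hk(1) by simp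
  qed
qed

section \<open>Products of linear polynomials\<close>

lemma homogeneous_mult:
  assumes "homogeneous d f" "homogeneous e g"
  shows "homogeneous (d + e) (f * g)"
  unfolding homogeneous_def
proof
  fix a assume "a \<in> Poly_Mapping.keys (f * g)"
  then obtain b c where "a = b + c" "b \<in> Poly_Mapping.keys f" "c \<in> Poly_Mapping.keys g"
    using keys_mult[of f g] by blast
  then show "(\<Sum>i\<in>UNIV. Poly_Mapping.lookup a i) = d + e"
    using assms by (simp add: homogeneous_def lookup_add sum.distrib)
qed

lemma homogeneous_prod_list:
  assumes "\<And>f. f \<in> set fs \<Longrightarrow> homogeneous 1 f"
  shows "homogeneous (length fs) (prod_list fs)"
  using assms
proof (induction fs)
  case Nil
  show ?case by (simp add: homogeneous_def)
next
  case (Cons f fs)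
  then show ?case using homogeneous_mult[of 1 f "length fs" "prod_list fs"] by simp
qed

definition linear_mpol :: "complex ^ 'n \<Rightarrow> ('n::finite) mpol"
  where "linear_mpol c = (\<Sum>i\<in>UNIV. Poly_Mapping.single (Poly_Mapping.single i 1) (c $ i))"

lemma eval_mpol_sum: "eval_mpol x (\<Sum>i\<in>A. f i) = (\<Sum>i\<in>A. eval_mpol x (f i))"
  by (induction A rule: infinite_finite_induct) (simp_all add: eval_mpol_add)

lemma eval_linear_mpol: "eval_mpol x (linear_mpol c) = lf c x"
proof -
  have "(\<Prod>j\<in>UNIV. x $ j ^ Poly_Mapping.lookup (Poly_Mapping.single i 1) j) = x $ i" for i
  proof -
    have "(\<Prod>j\<in>UNIV. x $ j ^ Poly_Mapping.lookup (Poly_Mapping.single i 1) j)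
      = (\<Prod>j\<in>UNIV. if j = i then x $ j else 1)"
      by (rule prod.cong) (auto simp: lookup_single)
    then show ?thesis by simp
  qed
  then show ?thesis by (simp add: linear_mpol_def eval_mpol_sum eval_mpol_single lf_def)
qed

lemma homogeneous_linear_mpol: "homogeneous 1 (linear_mpol c)"
  unfolding homogeneous_def
proof
  fix a assume "a \<in> Poly_Mapping.keys (linear_mpol c)"
  then have "a \<in> (\<Union>i. Poly_Mapping.keys (Poly_Mapping.single (Poly_Mapping.single i 1) (c $ i)))"
    using keys_sum[of "\<lambda>i. Poly_Mapping.single (Poly_Mapping.single i 1) (c $ i)" UNIV]
    unfolding linear_mpol_def by blast
  then obtain i where "a = Poly_Mapping.single i 1" by (auto split: if_splits)
  then show "(\<Sum>i\<in>UNIV. Poly_Mapping.lookup a i) = 1"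
    by (simp add: lookup_single when_def)
qed

lemma linear_mpol_point_ideal:
  assumes "lf c v = 0"
  shows "linear_mpol c \<in> point_ideal (proj_pt v)"
  unfolding point_ideal_def ideal_gen_def
  using assms homogeneous_linear_mpol linear_form_smult[OF linear_form_lf, of c _ v]
  by (intro module.span_base[OF module_mult]) (auto simp: proj_pt_def eval_linear_mpol)

section \<open>Waldschmidt constants of point sets cut out by an arrangement\<close>

text \<open>The product of the arrangement has degree \<open>length ls\<close> and lies in the
  symbolic power \<open>q\<close>, which gives the upper bound; \<open>x\<close> avoids all the
  planes and so certifies that the product is nonzero. The lower bound is \<open>bound\<close>,
  applied to a nonzero form of least degree.\<close>

lemma waldschmidt_arrangement:
  assumes ls: "list_all (\<lambda>l. dot l x \<noteq> 0) ls"
    and count: "\<And>p. p \<in> set ps \<Longrightarrow> q \<le> length (filter (\<lambda>l. dot l p = 0) ls)"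
    and q: "q \<ge> 1" "length ls * B = q * A" "B \<ge> 1"
    and bound: "\<And>d f m y. form d f \<Longrightarrow> (\<And>p. p \<in> set ps \<Longrightarrow> vanishes m f (cvec p)) \<Longrightarrow>
      B * d < A * m \<Longrightarrow> f y = 0"
  shows "waldschmidt ((proj_pt \<circ> cvec) ` set ps) = real A / real B"
proof -
  let ?Z = "(proj_pt \<circ> cvec) ` set ps"
  let ?Q = "\<lambda>m d. \<exists>f\<in>symbolic_power ?Z m. f \<noteq> 0 \<and> homogeneous d f"
  let ?fs = "\<lambda>k. concat (replicate k (map (linear_mpol \<circ> cvec) ls))"
  have ex: "?Q m (k * length ls)" if m: "m \<le> k * q" for m k
  proof (intro bexI conjI)
    have "eval_mpol (cvec x) (prod_list (?fs k)) \<noteq> 0"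
      using ls by (auto simp: eval_mpol_prod_list prod_list_zero_iff eval_linear_mpol lf_cvec list_all_iff)
    then show "prod_list (?fs k) \<noteq> 0" by auto
    have "homogeneous (length (?fs k)) (prod_list (?fs k))"
      using homogeneous_linear_mpol by (intro homogeneous_prod_list) (auto split: if_splits simp del: One_nat_def)
    moreover have "length (?fs k) = k * length ls" by (induction k) auto
    ultimately show "homogeneous (k * length ls) (prod_list (?fs k))" by simp
    show "prod_list (?fs k) \<in> symbolic_power ?Z m"
      unfolding symbolic_power_def
    proof (intro INT_I, elim imageE)
      fix P p assume P: "P = (proj_pt \<circ> cvec) p" "p \<in> set ps"
      let ?J = "point_ideal (proj_pt (cvec p))"
      have "length (filter (\<lambda>f. f \<in> ?J) (?fs k)) = k * length (filter (\<lambda>f. f \<in> ?J) (map (linear_mpol \<circ> cvec) ls))"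
        by (induction k) auto
      moreover have "length (filter (\<lambda>l. dot l p = 0) ls) \<le> length (filter (\<lambda>f. f \<in> ?J) (map (linear_mpol \<circ> cvec) ls))"
        by (induction ls) (auto simp: lf_cvec intro: linear_mpol_point_ideal)
      then have "k * q \<le> k * length (filter (\<lambda>f. f \<in> ?J) (map (linear_mpol \<circ> cvec) ls))"
        using count[OF P(2)] by (intro mult_le_mono2) linarith
      ultimately have "m \<le> length (filter (\<lambda>f. f \<in> ?J) (?fs k))" using m by linarith
      moreover have "prod_list (?fs k) \<in> ideal_pow ?J (length (filter (\<lambda>f. f \<in> ?J) (?fs k)))"
        by (rule prod_list_ideal_pow)
      ultimately show "prod_list (?fs k) \<in> ideal_pow (point_ideal P) m"
        using ideal_pow_antimono P(1) by fastforce
    qed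
  qed
  have lower: "real A / real B \<le> real (initial_degree (symbolic_power ?Z m)) / real m" if m: "m \<ge> 1" for m
  proof -
    \<comment> \<open>Taking \<open>m\<close> copies of the arrangement shows that some degree
      qualifies, so the minimum in \<open>initial_degree\<close> is attained.\<close>
    have "m \<le> m * q" using q(1) by simp
    from ex[OF this] have "?Q m (initial_degree (symbolic_power ?Z m))"
      unfolding initial_degree_def by (rule LeastI)
    then obtain f where f: "f \<in> symbolic_power ?Z m" "f \<noteq> 0" "homogeneous (initial_degree (symbolic_power ?Z m)) f"
      by blast
    obtain y where y: "eval_mpol y f \<noteq> 0" using mpol_eval_nonzero[OF f(2)] by blast
    have "vanishes m (\<lambda>x. eval_mpol x f) (cvec p)" if "p \<in> set ps" for p
      using f(1) that by (intro vanishes_ideal_pow) (auto simp: symbolic_power_def)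
    with bound[OF form_eval_mpol[OF f(3)]] y
    have "A * m \<le> B * initial_degree (symbolic_power ?Z m)" by (meson not_less)
    then have "real A * real m \<le> real B * real (initial_degree (symbolic_power ?Z m))"
      by (simp flip: of_nat_mult)
    then show ?thesis using m q(3) by (simp add: field_simps)
  qed
  have upper: "real (initial_degree (symbolic_power ?Z q)) / real q \<le> real A / real B"
  proof -
    have "initial_degree (symbolic_power ?Z q) \<le> 1 * length ls"
      unfolding initial_degree_def by (rule Least_le, rule ex) simp
    then have "real (initial_degree (symbolic_power ?Z q)) / real q \<le> real (length ls) / real q"
      by (intro divide_right_mono) simp_all
    also have "real (length ls) * real B = real q * real A" using q(2) by (simp flip: of_nat_mult)
    then have "real (length ls) / real q = real A / real B" using q(1,3) by (simp add: field_simps)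
    finally show ?thesis .
  qed
  show ?thesis
    unfolding waldschmidt_def
  proof (rule antisym)
    show "(INF m\<in>{1..}. real (initial_degree (symbolic_power ?Z m)) / real m) \<le> real A / real B"
      by (rule cINF_lower2[where x = q]) (use q(1) upper in \<open>auto intro!: bdd_belowI2[of _ 0]\<close>)
    show "real A / real B \<le> (INF m\<in>{1..}. real (initial_degree (symbolic_power ?Z m)) / real m)"
      using lower by (intro cINF_greatest) auto
  qed
qed

lemma points_eq:
  "D4_points = (proj_pt \<circ> cvec) ` set D4_vecs"
  "B4_points = (proj_pt \<circ> cvec) ` set (D4_vecs @ coord_vecs)"
  "F4_points = (proj_pt \<circ> cvec) ` set F4_vecs"
  unfolding projectivize_D4 projectivize_B4 projectivize_F4 projectivize_def F4_vecs_def
    D4_reps_def coord_reps_def sign_reps_def D4_vecs_def coord_vecs_def sign_vecs_def set_append image_Un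
  by (simp_all add: cvec.simps)

theorem theorem1p3:
  shows "waldschmidt D4_points = 2 \<and> waldschmidt B4_points = 2 \<and> waldschmidt F4_points = 8 / 3"
proof (intro conjI)
  \<comment> \<open>Points off all planes. In (1, 2, 5, 11) the entries are nonzero with distinct
    absolute values, and 11 > 1 + 2 + 5 excludes a vanishing signed sum.\<close>
  have c: "list_all (\<lambda>l. dot l (1, 1, 1, 1) \<noteq> 0) coord_vecs"
    "list_all (\<lambda>l. dot l (1, 2, 5, 11) \<noteq> 0) (map fst flags)" by code_simp+
  \<comment> \<open>Any set between \<open>D\<^sub>4\<close> and \<open>B\<^sub>4\<close> has
    constant 2, which settles both cases at once.\<close>
  have B4: "waldschmidt ((proj_pt \<circ> cvec) ` set ps) = real 2 / real 1"
    if ps: "set D4_vecs \<subseteq> set ps" "set ps \<subseteq> set (D4_vecs @ coord_vecs)" for ps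
  proof (rule waldschmidt_arrangement[OF c(1), where q = 2])
    show "2 \<le> length (filter (\<lambda>l. dot l p = 0) coord_vecs)" if "p \<in> set ps" for p
      using that ps(2) coord_count(1) unfolding list_all_iff by blast
    show "f y = 0" if "form d f" "\<And>p. p \<in> set ps \<Longrightarrow> vanishes m f (cvec p)" "1 * d < 2 * m" for d f m y
      by (rule D4_vanish[OF that(1) that(2)]) (use ps(1) that(3) in auto)
  qed (simp_all add: coord_vecs_def)
  show "waldschmidt D4_points = 2" using B4[of D4_vecs] by (simp add: points_eq)
  show "waldschmidt B4_points = 2" using B4[of "D4_vecs @ coord_vecs"] by (simp add: points_eq)
  have "waldschmidt ((proj_pt \<circ> cvec) ` set F4_vecs) = real 8 / real 3"
  proof (rule waldschmidt_arrangement[OF c(2), where q = 9])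
    show "9 \<le> length (filter (\<lambda>l. dot l p = 0) (map fst flags))" if "p \<in> set F4_vecs" for p
      using that mirrors_count unfolding list_all_iff by simp
    show "length (map fst flags) * 3 = 9 * 8" by (simp add: flags_def frames_def)
    show "f y = 0" if "form d f" "\<And>p. p \<in> set F4_vecs \<Longrightarrow> vanishes m f (cvec p)" "3 * d < 8 * m" for d f m y
      using that by (rule F4_vanish)
  qed simp_all
  then show "waldschmidt F4_points = 8 / 3" by (simp add: points_eq)
qed

end
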